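(* Let $p\ge 3$ be a prime and $r\ge 2p+1$. Then, as $\Gamma$-modules, $$X_{r-p,\,r}\simeq\begin{cases}X_{r/p-1,\,r/p}, & \text{if } \Sigma_p(r-p)<\Sigma_p(r-1),\\ X_{r-1,\,r}, & \text{if } \Sigma_p(r-p)=\Sigma_p(r-1),\\ X_{rp-1,\,rp}, & \text{if } \Sigma_p(r-p)>\Sigma_p(r-1).\end{cases}$$ (In the first case one has $p\mid r$, so that $r/p$ is an integer.)
   Context: Let $\Gamma=\mathrm{GL}_2(\mathbb{F}_p)$. For $n\ge 0$, $V_n$ is the $\mathbb{F}_p$-space of homogeneous polynomials $F(X,Y)$ of degree $n$ over $\mathbb{F}_p$, with action $\begin{pmatrix} a&b\\c&d\end{pmatrix}\cdot F(X,Y)=F(aX+cY,\,bX+dY)$ for $\begin{pmatrix} a&b\\c&d\end{pmatrix}\in\Gamma$. For $0\le l\le n$, $X_{n-l,\,n}\subseteq V_n$ is the $\mathbb{F}_p[\Gamma]$-submodule generated by the monomial $X^{n-l}Y^{l}$. $\Sigma_p(n)$ is the sum of the digits of the base $p$-expansion of $n\ge0$. *)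

theory Defs
  imports "HOL-Analysis.Determinants" "HOL-Computational_Algebra.Computational_Algebra"
begin

text \<open>
  A polynomial \<open>F(X,Y)\<close> over \<open>'a\<close> is an element of \<open>'a poly poly\<close>: the outer variable is \<open>Y\<close>,
  the inner one \<open>X\<close>, so \<open>coeff (coeff F j) i\<close> is the coefficient of \<open>X^i Y^j\<close>.
\<close>

definition varX :: "'a::comm_semiring_1 poly poly" where
  "varX = [:[:0, 1:]:]"

definition varY :: "'a::comm_semiring_1 poly poly" where
  "varY = [:0, 1:]"

definition scal :: "'a::comm_semiring_0 \<Rightarrow> 'a poly poly \<Rightarrow> 'a poly poly" where
  "scal c F = smult [:c:] F"

text \<open>\<open>subst2 F P Q\<close> is \<open>F(P,Q)\<close>.\<close>

definition subst2 :: "'a::comm_semiring_1 poly poly \<Rightarrow> 'a poly poly \<Rightarrow> 'a poly poly \<Rightarrow> 'a poly poly"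
  where "subst2 F P Q =
    (\<Sum>j\<le>degree F. \<Sum>i\<le>degree (coeff F j). scal (coeff (coeff F j) i) (P ^ i * Q ^ j))"

definition V :: "nat \<Rightarrow> 'a::comm_semiring_1 poly poly set" where
  "V n = {F. \<forall>i j. coeff (coeff F j) i \<noteq> 0 \<longrightarrow> i + j = n}"

definition GL2 :: "('a::field ^ 2 ^ 2) set" where
  "GL2 = {g. invertible g}"

text \<open>
  For \<open>g\<close> with rows \<open>(a, b)\<close> and \<open>(c, d)\<close>, \<open>(g \<cdot> F)(X,Y) = F(aX + cY, bX + dY)\<close>;
  \<open>g $ i $ j\<close> is the entry in row \<open>i\<close> and column \<open>j\<close>.
\<close>

definition act :: "'a::field ^ 2 ^ 2 \<Rightarrow> 'a poly poly \<Rightarrow> 'a poly poly" where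
  "act g F = subst2 F (scal (g $ 1 $ 1) varX + scal (g $ 2 $ 1) varY)
                      (scal (g $ 1 $ 2) varX + scal (g $ 2 $ 2) varY)"

text \<open>A submodule over the group algebra is a linear subspace stable under the group.\<close>

definition submodule_V :: "nat \<Rightarrow> 'a::field poly poly set \<Rightarrow> bool" where
  "submodule_V n W \<longleftrightarrow> W \<subseteq> V n \<and> module.subspace scal W \<and> (\<forall>g\<in>GL2. \<forall>F\<in>W. act g F \<in> W)"

text \<open>
  \<open>Xsub m n\<close> is the submodule \<open>X_{m,n}\<close> of \<open>V n\<close> generated by \<open>X^m Y^(n-m)\<close>; it is meant for
  \<open>m \<le> n\<close> only, since the subtraction is truncated.
\<close>

definition Xsub :: "nat \<Rightarrow> nat \<Rightarrow> 'a::field poly poly set" where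
  "Xsub m n = submodule_V n hull {varX ^ m * varY ^ (n - m)}"

definition GL2_isomorphic :: "'a::field poly poly set \<Rightarrow> 'a poly poly set \<Rightarrow> bool" where
  "GL2_isomorphic M N \<longleftrightarrow>
    (\<exists>\<phi>. bij_betw \<phi> M N \<and>
         (\<forall>F\<in>M. \<forall>G\<in>M. \<phi> (F + G) = \<phi> F + \<phi> G) \<and>
         (\<forall>c. \<forall>F\<in>M. \<phi> (scal c F) = scal c (\<phi> F)) \<and>
         (\<forall>g\<in>GL2. \<forall>F\<in>M. \<phi> (act g F) = act g (\<phi> F)))"

text \<open>The bound \<open>i \<le> n\<close> reaches every nonzero base-\<open>p\<close> digit, as \<open>n < p ^ n\<close> for \<open>p \<ge> 2\<close>.\<close>

definition digit_sum :: "nat \<Rightarrow> nat \<Rightarrow> nat" where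
  "digit_sum p n = (\<Sum>i\<le>n. (n div p ^ i) mod p)"

text \<open>
  \<open>V n\<close> is itself a submodule containing the monomials, so the hull in \<open>Xsub\<close> is an
  intersection of a nonempty family.
\<close>

lemma module_scal: "module (scal :: 'a::field \<Rightarrow> _)"
  by unfold_locales
     (simp_all add: scal_def smult_add_right mult.commute flip: smult_add_left one_pCons)

lemma V_add: "F \<in> V n \<Longrightarrow> G \<in> V n \<Longrightarrow> F + G \<in> V n"
  unfolding V_def by (auto, metis add_0)

lemma V_scal: "F \<in> V n \<Longrightarrow> scal c F \<in> V n"
  unfolding V_def scal_def by (auto, metis mult_zero_right)

lemma V_0: "0 \<in> V n"
  unfolding V_def by auto

lemma V_sum: "(\<And>x. x \<in> A \<Longrightarrow> f x \<in> V n) \<Longrightarrow> sum f A \<in> V n"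
  by (induction A rule: infinite_finite_induct) (auto intro: V_0 V_add)

lemma V_mult:
  assumes "F \<in> V m" "G \<in> V n"
  shows "F * G \<in> V (m + n)"
  unfolding V_def
proof (clarify)
  fix i j
  assume "coeff (coeff (F * G) j) i \<noteq> 0"
  then have "(\<Sum>k\<le>j. \<Sum>l\<le>i. coeff (coeff F k) l * coeff (coeff G (j - k)) (i - l)) \<noteq> 0"
    by (simp add: coeff_mult coeff_sum)
  then obtain k where k: "k \<le> j"
    and "(\<Sum>l\<le>i. coeff (coeff F k) l * coeff (coeff G (j - k)) (i - l)) \<noteq> 0"
    by (metis (no_types, lifting) atMost_iff sum.neutral)
  then obtain l where l: "l \<le> i" and "coeff (coeff F k) l * coeff (coeff G (j - k)) (i - l) \<noteq> 0"
    by (metis (no_types, lifting) atMost_iff sum.neutral)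
  then have "l + k = m" "(i - l) + (j - k) = n"
    using assms unfolding V_def by (metis (mono_tags, lifting) mem_Collect_eq mult_zero_left mult_zero_right)+
  then show "i + j = m + n"
    using k l by simp
qed

lemma V_power: "F \<in> V 1 \<Longrightarrow> F ^ n \<in> V n"
proof (induction n)
  case 0
  then show ?case
    by (auto simp: V_def coeff_1)
next
  case (Suc n)
  then show ?case
    using V_mult[of F 1 "F ^ n" n] by simp
qed

lemma varX_V: "varX \<in> V 1" and varY_V: "varY \<in> V 1"
  by (auto simp: V_def varX_def varY_def coeff_pCons split: nat.splits)

lemma monomial_V: "m \<le> n \<Longrightarrow> varX ^ m * varY ^ (n - m) \<in> V n"
  using V_mult[OF V_power[OF varX_V] V_power[OF varY_V], of m "n - m"] by simp

lemma act_V: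
  assumes "F \<in> V n"
  shows "act g F \<in> V n"
  unfolding act_def subst2_def
proof (intro V_sum)
  fix i j
  let ?P = "scal (g $ 1 $ 1) varX + scal (g $ 2 $ 1) varY"
  let ?Q = "scal (g $ 1 $ 2) varX + scal (g $ 2 $ 2) varY"
  show "scal (coeff (coeff F j) i) (?P ^ i * ?Q ^ j) \<in> V n"
  proof (cases "coeff (coeff F j) i = 0")
    case True
    then show ?thesis
      by (simp add: scal_def V_0)
  next
    case False
    then have "i + j = n"
      using assms by (auto simp: V_def)
    moreover have "?P ^ i * ?Q ^ j \<in> V (i + j)"
      by (intro V_mult V_power V_add V_scal varX_V varY_V)
    ultimately show ?thesis
      by (auto intro: V_scal)
  qed
qed

lemma submodule_V_V: "submodule_V n (V n)"
  unfolding submodule_V_def module.subspace_def[OF module_scal]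
  by (auto intro: V_0 V_add V_scal act_V)

end

theory Submission
  imports Defs "HOL-Number_Theory.Cong"
begin

text \<open>
  For a weight \<open>f\<close> on the group let \<open>f \<cdot> u = \<Sum>g. f(g) (g \<cdot> u)\<close>. The module generated by \<open>u\<close> consists of all
  \<open>f \<cdot> u\<close>, so it is determined up to isomorphism by the annihilator of \<open>u\<close>, the set of \<open>f\<close> with \<open>f \<cdot> u = 0\<close>
  (\<open>GL2_isomorphic_if_same_annihilator\<close>). Over the prime field, taking \<open>p\<close>-th powers is linear and commutes
  with the group, so \<open>X^i Y^j\<close> and \<open>X^(p i) Y^(p j)\<close> have the same annihilator (\<open>orbit_comb_frobenius\<close>). Hence
  the generator \<open>X^(n-1) Y\<close> may be replaced by \<open>X^(p n - p) Y^p\<close>. If \<open>p\<close> divides \<open>r\<close>, then \<open>n = r / p\<close> gives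
  \<open>X^(r-p) Y^p\<close>, and nothing more is needed. In the other two cases the annihilators of \<open>X^(s-p) Y^p\<close> have to
  be compared for \<open>s = r\<close> and \<open>s = p r\<close>, respectively \<open>s = p\<^sup>2 r\<close>; these numbers have the same digit sum.

  A matrix with rows \<open>(a, b)\<close> and \<open>(c, d)\<close> maps \<open>X^(r-p) Y^p\<close> to \<open>(a X + c Y)^(r-p) (b X^p + d Y^p)\<close>. With the
  moments \<open>\<beta> i j = \<Sum>g. f(g) b a^i c^j\<close> and \<open>\<delta> i j = \<Sum>g. f(g) d a^i c^j\<close>, the annihilator is given by the
  relations
  \<open>(r - p choose x - p) \<beta> (x - p) (r - x) + (r - p choose x) \<delta> x (r - p - x) = 0\<close> for \<open>x \<le> r\<close>.
  Since \<open>t^p = t\<close>, a moment depends only on its exponents modulo \<open>p - 1\<close> and on which of them are \<open>0\<close>, hence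
  only on their digit sums. By Lucas's theorem a binomial coefficient is nonzero modulo \<open>p\<close> exactly if the
  lower index is digitwise at most the upper one, and then digit sums add up.

  Let \<open>S\<close> be the digit sum of \<open>r\<close>, and suppose that at least two digits of \<open>r\<close> are nonzero. Let \<open>v\<close> be the
  lowest position above the units with a nonzero digit. For \<open>x\<close> digitwise below \<open>r\<close>, the relation at \<open>x\<close> is
  proportional to \<open>x\<^sub>v \<beta> + (r\<^sub>v - x\<^sub>v) \<delta> = 0\<close>. Moving a unit between the digit at \<open>v\<close> and another digit of \<open>x\<close>
  preserves the digit sum \<open>k\<close> of \<open>x\<close> but changes the relation, so for \<open>0 < k < S\<close> both moments vanish
  (\<open>digit_exchange\<close>). If \<open>v = 1\<close>, these are all moments that occur, apart from \<open>\<delta> 0 (r - p)\<close> and \<open>\<beta> (r - p) 0\<close>, which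
  also vanish (\<open>relations_iff_no_borrow\<close>). If \<open>v > 1\<close>, the remaining relations say that \<open>\<beta>\<close> and \<open>\<delta>\<close> agree
  (\<open>relations_iff_borrow\<close>). So the annihilator depends only on \<open>S\<close> and on whether \<open>p\<close> divides \<open>r div p\<close>
  (\<open>same_annihilator\<close>).

  Finally, comparing the digit sums of \<open>r - p\<close> and \<open>r - 1\<close> detects where \<open>r\<close> has zero digits: the first sum
  is the smaller one if \<open>p\<close> divides \<open>r\<close>. If not, it is the larger one if \<open>p\<close> divides \<open>r div p\<close>, and both are
  equal otherwise.
\<close>

section \<open>Digit sums\<close>

lemma digit_sum_eq_sum:
  assumes "p \<ge> 2" "n \<le> N"
  shows "digit_sum p n = (\<Sum>i\<le>N. (n div p ^ i) mod p)"
proof -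
  have "(n div p ^ i) mod p = 0" if "n < i" for i
  proof -
    have "i < p ^ i"
      using assms(1) by (simp add: power_gt_expt)
    with that show ?thesis
      by simp
  qed
  then show ?thesis
    unfolding digit_sum_def using assms(2) by (intro sum.mono_neutral_left) auto
qed

lemma digit_sum_0 [simp]: "digit_sum p 0 = 0"
  by (simp add: digit_sum_def)

lemma digit_sum_add_mult:
  assumes "p \<ge> 2" "d < p"
  shows "digit_sum p (d + p * m) = d + digit_sum p m"
proof -
  have le: "m \<le> d + p * m"
    using assms(1) by (simp add: trans_le_add2)
  have "digit_sum p (d + p * m) = (\<Sum>i\<le>Suc (d + p * m). ((d + p * m) div p ^ i) mod p)"
    by (rule digit_sum_eq_sum[OF assms(1)]) simp
  also have "\<dots> = (d + p * m) mod p + (\<Sum>i\<le>d + p * m. ((d + p * m) div p ^ Suc i) mod p)"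
    by (simp only: sum.atMost_Suc_shift) simp
  also have "(\<Sum>i\<le>d + p * m. ((d + p * m) div p ^ Suc i) mod p) = (\<Sum>i\<le>d + p * m. (m div p ^ i) mod p)"
    using assms by (simp add: div_mult2_eq)
  also have "\<dots> = digit_sum p m"
    by (rule digit_sum_eq_sum[OF assms(1) le, symmetric])
  finally show ?thesis
    using assms by simp
qed

lemma digit_sum_mult: "p \<ge> 2 \<Longrightarrow> digit_sum p (p * m) = digit_sum p m"
  using digit_sum_add_mult[of p 0 m] by simp

lemma digit_sum_power_mult: "p \<ge> 2 \<Longrightarrow> digit_sum p (p ^ e * m) = digit_sum p m"
  by (induction e) (simp_all add: digit_sum_mult mult.assoc)

lemma digits_induct [consumes 1, case_names 0 digit]:
  fixes p n :: nat
  assumes "p \<ge> 2"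
    and "P 0"
    and "\<And>d m. d < p \<Longrightarrow> d + p * m \<noteq> 0 \<Longrightarrow> P m \<Longrightarrow> P (d + p * m)"
  shows "P n"
proof (induction n rule: less_induct)
  case (less n)
  show ?case
  proof (cases "n = 0")
    case False
    then have "n div p < n"
      using assms(1) by simp
    moreover have "n = n mod p + p * (n div p)"
      by simp
    ultimately show ?thesis
      using assms(3)[of "n mod p" "n div p"] less False assms(1) by simp
  qed (use assms in simp)
qed

lemma digit_sum_eq_0_iff:
  assumes "p \<ge> 2"
  shows "digit_sum p n = 0 \<longleftrightarrow> n = 0"
  using assms
proof (induction n rule: digits_induct)
  case (digit d m)
  then show ?case
    using assms by (simp add: digit_sum_add_mult)
qed simp

lemma digit_sum_cong:
  assumes "p \<ge> 2"
  shows "[digit_sum p n = n] (mod (p - 1))"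
  using assms
proof (induction n rule: digits_induct)
  case (digit d m)
  have "[1 * m = p * m] (mod (p - 1))"
    using assms le_mod_geq[of "p - 1" p] by (intro cong_mult) (simp_all add: cong_def)
  then have "[d + digit_sum p m = d + p * m] (mod (p - 1))"
    using digit(3) by (intro cong_add) (auto intro: cong_trans)
  then show ?case
    using assms digit by (simp add: digit_sum_add_mult)
qed simp

lemma digit_sum_pred:
  assumes "p \<ge> 2" "\<not> p dvd n"
  shows "Suc (digit_sum p (n - 1)) = digit_sum p n"
proof -
  have nz: "n mod p \<noteq> 0"
    using assms(2) by (simp add: dvd_eq_mod_eq_0)
  have n: "n = n mod p + p * (n div p)"
    by simp
  have n1: "n - 1 = (n mod p - 1) + p * (n div p)"
    using n nz by linarith
  have "digit_sum p n = n mod p + digit_sum p (n div p)"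
    using assms by (subst n, subst digit_sum_add_mult) auto
  moreover have "digit_sum p (n - 1) = (n mod p - 1) + digit_sum p (n div p)"
    unfolding n1 using assms by (intro digit_sum_add_mult) (auto intro: less_imp_diff_less)
  ultimately show ?thesis
    using nz by simp
qed

lemma digit_sum_pred_mult:
  assumes "p \<ge> 2" "m > 0"
  shows "digit_sum p (p * m - 1) = p - 1 + digit_sum p (m - 1)"
proof -
  have "p * m - 1 = (p - 1) + p * (m - 1)"
    using assms by (cases m) auto
  then show ?thesis
    using assms digit_sum_add_mult[of p "p - 1" "m - 1"] by simp
qed

text \<open>
  A carry replaces digits \<open>p - 1\<close> by zeros, which only lowers the sum.
\<close>

lemma digit_sum_Suc_le:
  assumes "p \<ge> 2"
  shows "digit_sum p (Suc n) \<le> Suc (digit_sum p n)"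
proof (induction n rule: less_induct)
  case (less n)
  show ?case
  proof (cases "p dvd Suc n")
    case False
    then show ?thesis
      using digit_sum_pred[OF assms, of "Suc n"] by simp
  next
    case True
    then obtain m where m: "Suc n = p * Suc m"
      by (metis dvd_def mult_0_right nat.distinct(1) not0_implies_Suc)
    then have n: "n = p * Suc m - 1"
      by simp
    have "m < n"
      using mult_le_mono1[OF assms, of "Suc m"] unfolding m[symmetric] by simp
    then have "digit_sum p (Suc m) \<le> Suc (digit_sum p m)"
      by (rule less)
    moreover have "digit_sum p n = p - 1 + digit_sum p m"
      unfolding n using digit_sum_pred_mult[OF assms, of "Suc m"] by simp
    ultimately show ?thesis
      using assms digit_sum_mult[OF assms, of "Suc m"] m by simp
  qed
qed

section \<open>Binomial coefficients modulo \<open>p\<close>\<close>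

text \<open>
  This is the congruence \<open>(1 + X)^(n+p) \<equiv> (1 + X)^n (1 + X^p)\<close> read off at \<open>X^x\<close>: in the Vandermonde
  convolution only the terms with \<open>k = 0\<close> and \<open>k = p\<close> survive modulo \<open>p\<close>.
\<close>

lemma choose_add_prime_cong:
  assumes "prime p"
  shows "[(n + p) choose x = (n choose x) + (if p \<le> x then n choose (x - p) else 0)] (mod p)"
proof -
  have p2: "p \<ge> 2"
    using assms by (rule prime_ge_2_nat)
  let ?t = "\<lambda>k. (p choose k) * (n choose (x - k))"
  have split: "(\<Sum>k\<le>x. ?t k) = (n choose x) + (\<Sum>k\<in>{1..x}. ?t k)"
    by (simp add: sum.atMost_shift atLeast0AtMost[symmetric] sum.atLeast_Suc_atMost)
  have small: "p dvd ?t k" if "k \<ge> 1" "k \<noteq> p" for k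
    using that assms p2 by (cases "k < p") (auto simp: binomial_eq_0 intro!: dvd_mult2 dvd_choose_prime)
  have "[(\<Sum>k\<in>{1..x}. ?t k) = (if p \<le> x then n choose (x - p) else 0)] (mod p)"
  proof (cases "p \<le> x")
    case True
    then have "(\<Sum>k\<in>{1..x}. ?t k) = ?t p + (\<Sum>k\<in>{1..x} - {p}. ?t k)"
      using p2 by (intro sum.remove) auto
    moreover have "p dvd (\<Sum>k\<in>{1..x} - {p}. ?t k)"
      using small by (intro dvd_sum) auto
    ultimately show ?thesis
      using True by (simp add: cong_def mod_add_eq dvd_eq_mod_eq_0 flip: mod_add_right_eq)
  next
    case False
    then have "p dvd (\<Sum>k\<in>{1..x}. ?t k)"
      using small by (intro dvd_sum) auto
    with False show ?thesis
      by (simp add: cong_def dvd_eq_mod_eq_0)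
  qed
  then have "[(\<Sum>k\<le>x. ?t k) = (n choose x) + (if p \<le> x then n choose (x - p) else 0)] (mod p)"
    unfolding split by (intro cong_add) simp_all
  then show ?thesis
    using vandermonde[of p n x] by (simp add: add.commute)
qed

text \<open>
  Lucas's theorem, one digit at a time. Each increment of \<open>m\<close> adds \<open>p\<close> to the upper index, so the
  previous congruence turns into Pascal's rule for \<open>m choose k\<close>.
\<close>

lemma lucas_step:
  assumes "prime p" "d < p" "e < p"
  shows "[(d + p * m) choose (e + p * k) = (d choose e) * (m choose k)] (mod p)"
proof (induction m arbitrary: k)
  case 0
  show ?case
  proof (cases k)
    case (Suc k')
    then have "d < e + p * k"
      using assms by (simp add: trans_less_add1)
    with Suc show ?thesis
      by (simp add: binomial_eq_0)
  qed simp
next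
  case (Suc m)
  have "[((d + p * m) + p) choose (e + p * k) = ((d + p * m) choose (e + p * k)) +
      (if p \<le> e + p * k then (d + p * m) choose (e + p * k - p) else 0)] (mod p)"
    by (rule choose_add_prime_cong[OF assms(1)])
  also have "[((d + p * m) choose (e + p * k)) +
      (if p \<le> e + p * k then (d + p * m) choose (e + p * k - p) else 0) = (d choose e) * (Suc m choose k)] (mod p)"
  proof (cases k)
    case 0
    with Suc[of 0] assms show ?thesis
      by simp
  next
    case (Suc k')
    have "[((d + p * m) choose (e + p * k)) + ((d + p * m) choose (e + p * k')) =
      (d choose e) * (m choose k) + (d choose e) * (m choose k')] (mod p)"
      by (intro cong_add Suc.IH)
    with Suc show ?thesis
      by (simp add: algebra_simps)
  qed
  finally show ?case
    by (simp add: algebra_simps)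
qed

lemma prime_not_dvd_choose_step:
  assumes "prime p" "d < p" "e < p"
  shows "\<not> p dvd ((d + p * m) choose (e + p * k)) \<longleftrightarrow> e \<le> d \<and> \<not> p dvd (m choose k)"
proof -
  have "p dvd ((d + p * m) choose (e + p * k)) \<longleftrightarrow> p dvd (d choose e) * (m choose k)"
    by (rule cong_dvd_iff[OF lucas_step[OF assms]])
  also have "\<dots> \<longleftrightarrow> d < e \<or> p dvd (m choose k)"
  proof (cases "d < e")
    case False
    have "\<not> p dvd fact d"
      using assms by (simp add: prime_dvd_fact_iff)
    then have "\<not> p dvd (d choose e)"
      using False binomial_fact_lemma[of e d] by (metis dvd_mult linorder_not_less)
    with False assms(1) show ?thesis
      by (simp add: prime_dvd_mult_iff)
  qed (simp add: binomial_eq_0)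
  finally show ?thesis
    by auto
qed

text \<open>
  If the coefficient is nonzero modulo \<open>p\<close>, every digit of \<open>x\<close> is at most the corresponding digit of
  \<open>n\<close>, so \<open>n - x\<close> is computed without borrowing.
\<close>

lemma digit_sum_add_if_not_dvd_choose:
  assumes "prime p" "\<not> p dvd (n choose x)"
  shows "digit_sum p x + digit_sum p (n - x) = digit_sum p n"
  using prime_ge_2_nat[OF assms(1)] assms(2)
proof (induction n arbitrary: x rule: digits_induct)
  case 0
  then show ?case
    by (cases x) auto
next
  case (digit d m)
  define e k where "e = x mod p" and "k = x div p"
  have p2: "p \<ge> 2"
    by (rule prime_ge_2_nat[OF assms(1)])
  have x: "x = e + p * k" "e < p"
    using p2 by (simp_all add: e_def k_def)
  have *: "e \<le> d" "\<not> p dvd (m choose k)"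
    using prime_not_dvd_choose_step[OF assms(1) digit(1) x(2)] digit(4) x(1) by auto
  then have "k \<le> m"
    by (metis binomial_eq_0 dvd_0_right not_le)
  then have "d + p * m - x = (d - e) + p * (m - k)"
    using *(1) mult_le_mono2[of k m p] unfolding x(1) diff_mult_distrib2 by linarith
  then have "digit_sum p (d + p * m - x) = (d - e) + digit_sum p (m - k)"
    using p2 digit(1) by (simp only: digit_sum_add_mult less_imp_diff_less)
  then show ?case
    using digit(3)[OF *(2)] p2 x digit(1) * by (simp add: digit_sum_add_mult)
qed

text \<open>
  The digits of \<open>y\<close> may be any numbers below those of \<open>m\<close>; filling them up greedily from the lowest
  position reaches every digit sum up to that of \<open>m\<close>.
\<close>

lemma ex_not_dvd_choose_digit_sum:
  assumes "prime p" "b \<le> digit_sum p m"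
  shows "\<exists>y. \<not> p dvd (m choose y) \<and> digit_sum p y = b"
  using prime_ge_2_nat[OF assms(1)] assms(2)
proof (induction m arbitrary: b rule: digits_induct)
  case 0
  then show ?case
    using assms(1) by (intro exI[of _ 0]) auto
next
  case (digit d m)
  have p2: "p \<ge> 2"
    by (rule prime_ge_2_nat[OF assms(1)])
  define e where "e = min d b"
  have "b - e \<le> digit_sum p m"
    using digit p2 by (auto simp: digit_sum_add_mult e_def)
  from digit(3)[OF this] obtain k where k: "\<not> p dvd (m choose k)" "digit_sum p k = b - e"
    by blast
  have "e < p" "e \<le> d"
    using digit(1) by (simp_all add: e_def)
  then show ?case
    using prime_not_dvd_choose_step[OF assms(1) digit(1), of e m k] k p2
    by (intro exI[of _ "e + p * k"]) (auto simp: digit_sum_add_mult e_def)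
qed

section \<open>Relations between the moments\<close>

lemma cong_cancel_nat:
  fixes a b x y m :: nat
  assumes "[a + x = b + y] (mod m)" "[x = y] (mod m)"
  shows "[a = b] (mod m)"
proof -
  have "[a + x = b + x] (mod m)"
    using assms by (meson cong_add_lcancel_nat cong_sym cong_trans)
  then show ?thesis
    by (simp add: cong_add_rcancel_nat)
qed

lemma cong_add_modulus:
  fixes a b m :: nat
  shows "[a = b] (mod m) \<Longrightarrow> [a = b + m] (mod m)"
  unfolding cong_def by (simp only: mod_add_self2)

lemma prime_not_dvd_choose_power_mult:
  assumes "prime p"
  shows "\<not> p dvd ((p ^ e * c) choose (p ^ e * z)) \<longleftrightarrow> \<not> p dvd (c choose z)"
  using prime_not_dvd_choose_step[OF assms, of 0 0] prime_gt_0_nat[OF assms]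
  by (induction e) (simp_all add: mult.assoc)

text \<open>
  Division-free form of \<open>(n - 1 choose k) = (n - k) / n * (n choose k)\<close> at \<open>n = Q c\<close> and \<open>k = Q z\<close>. The
  common factor \<open>Q\<close> cancels over the integers, so the identity keeps its content modulo \<open>p\<close> even when
  \<open>p\<close> divides \<open>Q\<close>.
\<close>

lemma choose_mult_pred:
  fixes Q c z :: nat
  assumes "Q > 0"
  shows "c * ((Q * c - 1) choose (Q * z)) + z * ((Q * c) choose (Q * z)) = c * ((Q * c) choose (Q * z))"
proof (cases "z \<le> c")
  case True
  have "Q * ((c - z) * ((Q * c) choose (Q * z))) = Q * (c * ((Q * c - 1) choose (Q * z)))"
    using binomial_absorb_comp[of "Q * c" "Q * z"] unfolding mult.assoc[symmetric] diff_mult_distrib2 .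
  then have "(c - z) * ((Q * c) choose (Q * z)) = c * ((Q * c - 1) choose (Q * z))"
    using assms by simp
  then show ?thesis
    using True by (metis add_mult_distrib le_add_diff_inverse2)
next
  case False
  with assms have "Q * c < Q * z"
    by simp
  moreover from this have "Q * c - 1 < Q * z"
    by linarith
  ultimately show ?thesis
    by (simp add: binomial_eq_0 del: One_nat_def)
qed

text \<open>
  The coefficient of \<open>X^x\<close> in \<open>X^p (1 + X)^n\<close>.
\<close>

definition lower_coeff :: "nat \<Rightarrow> nat \<Rightarrow> nat \<Rightarrow> nat" where
  "lower_coeff p n x = (if p \<le> x then n choose (x - p) else 0)"

lemma choose_prime_pred_cong:
  assumes "prime p" "p \<le> r"
  shows "[lower_coeff p (r - p) x + ((r - p) choose x) = r choose x] (mod p)"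
  using cong_sym[OF choose_add_prime_cong[OF assms(1), of "r - p" x]] assms(2)
  by (simp add: lower_coeff_def add.commute)

text \<open>
  It is applied with \<open>c\<close> equal to \<open>r div p\<close> stripped of its factors \<open>p\<close>, so that its last
  digit is the lowest nonzero digit of \<open>r\<close> above the units. By \<open>choose_prime_pred_cong\<close>, \<open>r choose x\<close> is the sum of the two coefficients
  of the relation at \<open>x\<close>; the lemma says that it splits between them in the proportion \<open>z : (c - z)\<close>.
\<close>

lemma choose_row_weights:
  fixes p e c r0 z i :: nat
  defines "r \<equiv> r0 + p * (p ^ e * c)" and "x \<equiv> i + p * (p ^ e * z)"
  assumes "prime p" "r0 < p" "i < p" "c > 0"
  shows "[c * ((r - p) choose x) + z * (r choose x) = c * (r choose x)] (mod p)"
proof -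
  have p0: "p > 0"
    using assms by (simp add: prime_gt_0_nat)
  then have pos: "p ^ e * c > 0"
    using assms by simp
  then have r_p: "r - p = r0 + p * (p ^ e * c - 1)"
    using mult_le_mono2[of 1 "p ^ e * c" p] unfolding r_def diff_mult_distrib2 by simp
  have 1: "[(r - p) choose x = (r0 choose i) * ((p ^ e * c - 1) choose (p ^ e * z))] (mod p)"
    unfolding r_p x_def by (rule lucas_step) (use assms in auto)
  have 2: "[r choose x = (r0 choose i) * ((p ^ e * c) choose (p ^ e * z))] (mod p)"
    unfolding r_def x_def by (rule lucas_step) (use assms in auto)
  have "[c * ((r - p) choose x) + z * (r choose x) =
     c * ((r0 choose i) * ((p ^ e * c - 1) choose (p ^ e * z))) +
     z * ((r0 choose i) * ((p ^ e * c) choose (p ^ e * z)))] (mod p)"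
    by (intro cong_add cong_mult 1 2) simp_all
  also have "c * ((r0 choose i) * ((p ^ e * c - 1) choose (p ^ e * z))) +
     z * ((r0 choose i) * ((p ^ e * c) choose (p ^ e * z))) =
     (r0 choose i) * (c * ((p ^ e * c - 1) choose (p ^ e * z)) + z * ((p ^ e * c) choose (p ^ e * z)))"
    by (simp add: algebra_simps)
  also have "\<dots> = c * ((r0 choose i) * ((p ^ e * c) choose (p ^ e * z)))"
    using p0 by (subst choose_mult_pred) simp_all
  also have "[c * ((r0 choose i) * ((p ^ e * c) choose (p ^ e * z))) = c * (r choose x)] (mod p)"
    by (intro cong_mult cong_sym[OF 2]) simp
  finally show ?thesis .
qed

text \<open>
  The moments are meant to be \<open>\<beta> i j = (\<Sum>g. f g * b * a^i * c^j)\<close> and \<open>\<delta> i j = (\<Sum>g. f g * d * a^i * c^j)\<close>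
  for a weight \<open>f\<close> on the matrices \<open>g\<close> with rows \<open>(a, b)\<close> and \<open>(c, d)\<close>. All that the argument uses about
  them is what \<open>t^p = t\<close> gives: an exponent counts only modulo \<open>p - 1\<close>, except that the exponent \<open>0\<close> is
  to be distinguished from the positive multiples of \<open>p - 1\<close>, since \<open>t^0 = 1\<close> also at \<open>t = 0\<close>.
\<close>

locale moments =
  fixes p :: nat and \<beta> \<delta> :: "nat \<Rightarrow> nat \<Rightarrow> 'a::field"
  assumes prime_p: "prime p" and char_p: "CHAR('a) = p"
    and \<beta>_cong: "\<And>i j i' j'. [i = i'] (mod (p - 1)) \<Longrightarrow> (i = 0 \<longleftrightarrow> i' = 0) \<Longrightarrow>
      [j = j'] (mod (p - 1)) \<Longrightarrow> (j = 0 \<longleftrightarrow> j' = 0) \<Longrightarrow> \<beta> i j = \<beta> i' j'"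
    and \<delta>_cong: "\<And>i j i' j'. [i = i'] (mod (p - 1)) \<Longrightarrow> (i = 0 \<longleftrightarrow> i' = 0) \<Longrightarrow>
      [j = j'] (mod (p - 1)) \<Longrightarrow> (j = 0 \<longleftrightarrow> j' = 0) \<Longrightarrow> \<delta> i j = \<delta> i' j'"
begin

text \<open>
  The coefficient of \<open>X^x Y^(r-x)\<close> in \<open>\<Sum>g. f g * (a X + c Y)^(r-p) * (b X^p + d Y^p)\<close>, set to zero.
\<close>

definition relation :: "nat \<Rightarrow> nat \<Rightarrow> bool" where
  "relation r x \<longleftrightarrow> of_nat (lower_coeff p (r - p) x) * \<beta> (x - p) (r - x)
      + of_nat ((r - p) choose x) * \<delta> x (r - p - x) = 0"

lemma p_ge_2: "p \<ge> 2"
  using prime_p by (rule prime_ge_2_nat)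

lemma of_nat_eq_0_iff_dvd: "of_nat m = (0 :: 'a) \<longleftrightarrow> p dvd m"
  using of_nat_eq_0_iff_char_dvd[where 'a = 'a] char_p by simp

lemma of_nat_eq_if_cong: "[m = m'] (mod p) \<Longrightarrow> of_nat m = (of_nat m' :: 'a)"
  using of_nat_eq_iff_cong_CHAR[where 'a = 'a] char_p by simp

lemma moments_digit_sum:
  "\<beta> i j = \<beta> (digit_sum p i) (digit_sum p j)" "\<delta> i j = \<delta> (digit_sum p i) (digit_sum p j)"
  by (rule \<beta>_cong \<delta>_cong; simp add: cong_sym[OF digit_sum_cong] digit_sum_eq_0_iff p_ge_2 del: One_nat_def)+

text \<open>
  Let \<open>v\<close> be the position of the last digit of \<open>c\<close> inside \<open>r\<close>. For \<open>x\<close> digitwise below \<open>r\<close> the relation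
  at \<open>x\<close> is proportional to \<open>a B + (c\<^sub>0 - a) D = 0\<close>, where \<open>a\<close> and \<open>c\<^sub>0\<close> are the digits of \<open>x\<close> and \<open>r\<close> at \<open>v\<close>.
  As \<open>r\<close> has a nonzero digit elsewhere and \<open>k\<close> lies strictly between \<open>0\<close> and the digit sum of \<open>r\<close>, one
  unit can be moved between position \<open>v\<close> and the other positions without changing the digit sum \<open>k\<close> of
  \<open>x\<close>. The relations for \<open>a\<close> and \<open>a + 1\<close> have determinant \<open>-c\<^sub>0\<close>, which is invertible.
\<close>

lemma digit_exchange:
  fixes B D :: 'a and r0 e c k :: nat
  defines "r \<equiv> r0 + p * (p ^ e * c)"
  assumes r0: "r0 < p" and c: "\<not> p dvd c" and two_digits: "0 < r0 \<or> p \<le> c"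
    and k: "1 \<le> k" "k < digit_sum p r"
    and rel: "\<And>x. \<not> p dvd (r choose x) \<Longrightarrow> digit_sum p x = k \<Longrightarrow>
      of_nat (lower_coeff p (r - p) x) * B + of_nat ((r - p) choose x) * D = 0"
  shows "B = 0 \<and> D = 0"
proof -
  define c0 c1 m where "c0 = c mod p" and "c1 = c div p" and "m = r0 + p * c1"
  have p0: "p > 0"
    using p_ge_2 by simp
  have c_eq: "c = c0 + p * c1" and c0_less: "c0 < p"
    using p0 by (simp_all add: c0_def c1_def)
  have c0_pos: "c0 > 0"
    using c by (simp add: c0_def dvd_eq_mod_eq_0)
  then have c_pos: "c > 0"
    by (simp add: c_eq)
  have "p * 1 \<le> p * (p ^ e * c)"
    by (rule mult_le_mono2) (use c_pos p0 in \<open>simp add: Suc_le_eq\<close>)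
  then have p_le_r: "p \<le> r"
    unfolding r_def by linarith
  have r_sum: "digit_sum p r = c0 + digit_sum p m"
    using p_ge_2 r0 c0_less
    by (simp add: r_def m_def digit_sum_add_mult digit_sum_power_mult c_eq)
  have "m \<noteq> 0"
    using two_digits p0 by (auto simp: m_def c1_def div_eq_0_iff)
  then have m_sum: "digit_sum p m > 0"
    using digit_sum_eq_0_iff[OF p_ge_2, of m] by simp
  have weighted: "of_nat a * B + (of_nat c0 - of_nat a) * D = 0"
    if "a \<le> c0" "a \<le> k" and y: "\<not> p dvd (m choose y)" "digit_sum p y = k - a" for a y
  proof -
    define i z where "i = y mod p" and "z = a + p * (y div p)"
    define x where "x = i + p * (p ^ e * z)"
    have y_eq: "y = i + p * (y div p)" and i: "i < p"
      using p0 by (simp_all add: i_def)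
    have a: "a < p"
      using that(1) c0_less by simp
    have "i \<le> r0" "\<not> p dvd (c1 choose (y div p))"
      using y(1) prime_not_dvd_choose_step[OF prime_p r0 i, of c1 "y div p"] y_eq
      by (simp_all add: m_def)
    then have nz: "\<not> p dvd (r choose x)"
      unfolding r_def x_def prime_not_dvd_choose_step[OF prime_p r0 i]
        prime_not_dvd_choose_power_mult[OF prime_p]
      unfolding c_eq z_def prime_not_dvd_choose_step[OF prime_p c0_less a]
      using that(1) by simp
    have "digit_sum p y = i + digit_sum p (y div p)"
      using p_ge_2 i by (subst y_eq) (rule digit_sum_add_mult)
    then have "digit_sum p x = k"
      using p_ge_2 i a that(2) y(2)
      by (simp add: x_def z_def digit_sum_add_mult digit_sum_power_mult)
    from rel[OF nz this]
    have "of_nat c * of_nat (lower_coeff p (r - p) x) * B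
        + of_nat c * of_nat ((r - p) choose x) * D = 0"
      by (simp add: mult.assoc flip: distrib_left)
    moreover have upper: "of_nat c * of_nat ((r - p) choose x) = (of_nat c - of_nat z) * (of_nat (r choose x) :: 'a)"
      using of_nat_eq_if_cong[OF choose_row_weights[OF prime_p r0 i c_pos, of e z]]
      by (simp add: r_def x_def left_diff_distrib eq_diff_eq)
    moreover have "of_nat (lower_coeff p (r - p) x) + of_nat ((r - p) choose x) = (of_nat (r choose x) :: 'a)"
      using of_nat_eq_if_cong[OF choose_prime_pred_cong[OF prime_p p_le_r]] by simp
    then have "of_nat c * of_nat (lower_coeff p (r - p) x) = of_nat z * (of_nat (r choose x) :: 'a)"
      using upper by (simp add: algebra_simps flip: eq_diff_eq)
    ultimately have "of_nat (r choose x) * (of_nat z * B + (of_nat c - of_nat z) * D) = 0"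
      by (simp add: algebra_simps)
    then have "of_nat z * B + (of_nat c - of_nat z) * D = 0"
      using nz by (simp add: of_nat_eq_0_iff_dvd)
    moreover have "of_nat z = (of_nat a :: 'a)" "of_nat c = (of_nat c0 :: 'a)"
      by (rule of_nat_eq_if_cong, simp add: z_def c_eq cong_def)+
    ultimately show ?thesis
      by simp
  qed
  \<comment> \<open>The digits at \<open>v\<close> are to be \<open>a\<close> and \<open>a + 1\<close>; the rest of \<open>x\<close> gets what is left of \<open>k\<close>.\<close>
  define a where "a = min (c0 - 1) (k - 1)"
  have a: "a < c0" "a < k" "k - a \<le> digit_sum p m" "k - Suc a \<le> digit_sum p m"
    using c0_pos k m_sum r_sum by (auto simp: a_def)
  obtain y y' where "\<not> p dvd (m choose y)" "digit_sum p y = k - a"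
    and "\<not> p dvd (m choose y')" "digit_sum p y' = k - Suc a"
    using ex_not_dvd_choose_digit_sum[OF prime_p] a(3,4) by meson
  then have 1: "of_nat a * B + (of_nat c0 - of_nat a) * D = 0"
    and 2: "of_nat (Suc a) * B + (of_nat c0 - of_nat (Suc a)) * D = 0"
    using a by (auto intro: weighted simp del: of_nat_Suc)
  have "B - D = (of_nat (Suc a) * B + (of_nat c0 - of_nat (Suc a)) * D)
      - (of_nat a * B + (of_nat c0 - of_nat a) * D)"
    by (simp add: algebra_simps)
  then have "B = D"
    using 1 2 by simp
  moreover from this 1 have "of_nat c0 * D = 0"
    by (simp add: algebra_simps)
  then have "D = 0"
    using c0_pos c0_less by (auto simp: of_nat_eq_0_iff_dvd dest: dvd_imp_le)
  ultimately show ?thesis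
    by simp
qed

text \<open>
  When \<open>p\<close> does not divide \<open>c\<close>, the digit sum of \<open>r - p\<close> is one less than that of \<open>r\<close>. A moment that
  occurs with a nonzero coefficient then has exponents whose digit sums add up to exactly
  \<open>digit_sum p r - 1\<close>, and all such moments vanish by the exchange argument; the two extreme ones,
  \<open>\<beta> (r - p) 0\<close> and \<open>\<delta> 0 (r - p)\<close>, vanish by the relations at \<open>x = r\<close> and \<open>x = 0\<close>.
\<close>

lemma relations_iff_no_borrow:
  fixes r0 c :: nat
  defines "r \<equiv> r0 + p * c"
  assumes r0: "r0 < p" and c: "\<not> p dvd c" and two_digits: "0 < r0 \<or> p \<le> c"
  shows "(\<forall>x\<le>r. relation r x) \<longleftrightarrow> (\<forall>i j. Suc (i + j) = digit_sum p r \<longrightarrow> \<beta> i j = 0 \<and> \<delta> i j = 0)"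
proof -
  define n S where "n = r - p" and "S = digit_sum p r"
  have c_pos: "c > 0"
    using c by (cases c) auto
  have p0: "p > 0"
    using p_ge_2 by simp
  have p_le_r: "p \<le> r"
    using c_pos by (cases c) (simp_all add: r_def)
  have n_eq: "n = r0 + p * (c - 1)"
    using c_pos by (cases c) (simp_all add: n_def r_def)
  have n_sum: "Suc (digit_sum p n) = S"
    using digit_sum_pred[OF p_ge_2 c] r0 p_ge_2 by (simp add: n_eq S_def r_def digit_sum_add_mult)
  have le_if_nz: "x \<le> n'" if "\<not> p dvd (n' choose x)" for n' x
    using that by (metis binomial_eq_0 dvd_0_right not_le)
  have upper: "of_nat (n choose x) * \<delta> x (n - x)
      = of_nat (n choose x) * \<delta> (digit_sum p x) (digit_sum p n - digit_sum p x)" for x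
  proof (cases "p dvd (n choose x)")
    case False
    then have "digit_sum p (n - x) = digit_sum p n - digit_sum p x"
      using digit_sum_add_if_not_dvd_choose[OF prime_p False] by linarith
    then show ?thesis
      using moments_digit_sum(2)[of x "n - x"] by simp
  qed (simp add: of_nat_eq_0_iff_dvd[THEN iffD2])
  have lower: "of_nat (lower_coeff p n x) * \<beta> (x - p) (r - x)
      = of_nat (lower_coeff p n x) * \<beta> (digit_sum p n - digit_sum p (r - x)) (digit_sum p (r - x))" for x
  proof (cases "p dvd lower_coeff p n x")
    case False
    then have "p \<le> x" "\<not> p dvd (n choose (x - p))"
      by (auto simp: lower_coeff_def split: if_splits)
    then have "digit_sum p (x - p) = digit_sum p n - digit_sum p (r - x)"
      using digit_sum_add_if_not_dvd_choose[OF prime_p, of n "x - p"] by (simp add: n_def)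
    then show ?thesis
      using moments_digit_sum(1)[of "x - p" "r - x"] by simp
  qed (simp add: of_nat_eq_0_iff_dvd[THEN iffD2])
  show ?thesis
    unfolding S_def[symmetric]
  proof (intro iffI allI impI)
    assume rel: "\<forall>x\<le>r. relation r x"
    have interior: "\<beta> (k - 1) (S - k) = 0 \<and> \<delta> k (S - 1 - k) = 0" if k: "1 \<le> k" "k < S" for k
    proof (rule digit_exchange[of r0 c k 0])
      fix x
      assume x: "\<not> p dvd (r0 + p * (p ^ 0 * c) choose x)" "digit_sum p x = k"
      then have x_r: "x \<le> r" and sums: "digit_sum p (r - x) = S - k"
        using le_if_nz[of r x] digit_sum_add_if_not_dvd_choose[OF prime_p, of r x]
        by (auto simp: S_def r_def)
      then have "digit_sum p n - digit_sum p (r - x) = k - 1" "digit_sum p n = S - 1"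
        using n_sum k by auto
      then show "of_nat (lower_coeff p (r0 + p * (p ^ 0 * c) - p) x) * \<beta> (k - 1) (S - k)
          + of_nat (r0 + p * (p ^ 0 * c) - p choose x) * \<delta> k (S - 1 - k) = 0"
        using rel[rule_format, OF x_r] upper[of x] lower[of x] x sums
        by (simp add: relation_def flip: n_def r_def)
    qed (use r0 c two_digits k in \<open>auto simp: S_def r_def\<close>)
    fix i j
    assume ij: "Suc (i + j) = S"
    have "\<beta> i j = 0"
    proof (cases j)
      case 0
      have "relation r r"
        using rel by simp
      then have "\<beta> n 0 = 0"
        using p_le_r p0 by (simp add: relation_def lower_coeff_def n_def binomial_eq_0)
      moreover have "i = digit_sum p n"
        using 0 ij n_sum by simp
      ultimately show ?thesis
        using 0 moments_digit_sum(1)[of n 0] by simp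
    next
      case (Suc j')
      then have "S - Suc i = j"
        using ij by simp
      then show ?thesis
        using interior[of "Suc i"] ij Suc by simp
    qed
    moreover have "\<delta> i j = 0"
    proof (cases i)
      case 0
      have "relation r 0"
        using rel by simp
      then have "\<delta> 0 n = 0"
        using p0 by (simp add: relation_def lower_coeff_def n_def)
      moreover have "j = digit_sum p n"
        using 0 ij n_sum by simp
      ultimately show ?thesis
        using 0 moments_digit_sum(2)[of 0 n] by simp
    next
      case (Suc i')
      then have "S - 1 - i = j"
        using ij by simp
      then show ?thesis
        using interior[of i] ij Suc by simp
    qed
    ultimately show "\<beta> i j = 0 \<and> \<delta> i j = 0" ..
  next
    fix x
    assume zero: "\<forall>i j. Suc (i + j) = S \<longrightarrow> \<beta> i j = 0 \<and> \<delta> i j = 0" and "x \<le> r"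
    have "of_nat (n choose x) * \<delta> x (n - x) = 0"
    proof (cases "p dvd (n choose x)")
      case False
      then have "digit_sum p x \<le> digit_sum p n"
        using digit_sum_add_if_not_dvd_choose[OF prime_p False] by linarith
      then show ?thesis
        using zero n_sum by (simp add: upper)
    qed (simp add: of_nat_eq_0_iff_dvd[THEN iffD2])
    moreover have "of_nat (lower_coeff p n x) * \<beta> (x - p) (r - x) = 0"
    proof (cases "p dvd lower_coeff p n x")
      case False
      then have "p \<le> x" "\<not> p dvd (n choose (x - p))"
        by (auto simp: lower_coeff_def split: if_splits)
      then have "digit_sum p (r - x) \<le> digit_sum p n"
        using digit_sum_add_if_not_dvd_choose[OF prime_p, of n "x - p"] by (simp add: n_def)
      then show ?thesis
        using zero n_sum by (simp add: lower)
    qed (simp add: of_nat_eq_0_iff_dvd[THEN iffD2])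
    ultimately show "relation r x"
      unfolding relation_def n_def[symmetric] by (simp only: add_0_left)
  qed
qed

text \<open>
  The solutions of the relations when the subtraction \<open>r - p\<close> borrows, described by \<open>S = digit_sum p r\<close>
  alone. Adding \<open>p - 2\<close> to an exponent subtracts \<open>1\<close> modulo \<open>p - 1\<close> and keeps a positive exponent
  positive, so \<open>\<beta> i j = \<delta> (i + 1) (j - 1)\<close> is what the equations between moments say. Moments with an
  exponent \<open>0\<close> are listed apart, because they are not determined by the residue classes.
\<close>

definition linked :: "nat \<Rightarrow> bool" where
  "linked S \<longleftrightarrow>
    (\<forall>j\<ge>1. [Suc j = S] (mod (p - 1)) \<longrightarrow>
      \<delta> 0 j = 0 \<and> \<beta> j 0 = 0 \<and> \<beta> 0 j = \<delta> 1 (j + (p - 2)) \<and> \<delta> j 0 = \<beta> (j + (p - 2)) 1) \<and>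
    (\<forall>i\<ge>1. \<forall>j\<ge>1. [Suc (i + j) = S] (mod (p - 1)) \<longrightarrow>
      \<beta> i j = \<delta> (Suc i) (j + (p - 2)) \<and>
      (\<forall>k. 1 \<le> k \<and> k < S \<and> [Suc i = k] (mod (p - 1)) \<longrightarrow> \<beta> i j = 0))"

text \<open>
  Now \<open>r choose p\<close> is \<open>0\<close> modulo \<open>p\<close>, because the digit of \<open>r\<close> at position one is zero. The two
  coefficients of the relation at \<open>x\<close> add up to \<open>r choose x\<close>. If this vanishes, the relation says that
  its two moments agree or it is empty; if not, \<open>x\<close> is digitwise below \<open>r\<close>, and the exchange argument
  kills both moments. The moments with an exponent \<open>0\<close> enter only at \<open>x = 0, p, r - p, r\<close>.
\<close>

lemma relations_iff_borrow:
  fixes r0 e c :: nat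
  defines "r \<equiv> r0 + p * (p ^ Suc e * c)"
  assumes r0: "r0 < p" and c: "\<not> p dvd c" and two_digits: "0 < r0 \<or> p \<le> c"
  shows "(\<forall>x\<le>r. relation r x) \<longleftrightarrow> linked (digit_sum p r)"
proof -
  define n S M where "n = r - p" and "S = digit_sum p r" and "M = p ^ e * c"
  have p2: "p \<ge> 2" and p0: "p > 0"
    using p_ge_2 by simp_all
  have c_pos: "c > 0"
    using c by (cases c) auto
  then have M_pos: "M > 0"
    using p0 by (simp add: M_def)
  have r_eq: "r = r0 + p * (p * M)"
    by (simp add: r_def M_def)
  have pM: "p \<le> p * M"
    using M_pos by simp
  have "p * 2 \<le> p * (p * M)"
    using p2 pM by (intro mult_le_mono2) linarith
  then have "2 * p \<le> p * (p * M)"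
    by simp
  moreover have "2 * p \<noteq> r"
  proof
    assume eq: "2 * p = r"
    then have "r0 = 0" "p * (p * M) = p * 2"
      using \<open>2 * p \<le> p * (p * M)\<close> unfolding r_eq by linarith+
    then have "p * M = 2"
      using p0 by (metis mult_cancel1 neq0_conv)
    then have "M = 1"
      using p2 M_pos by (cases "M = 1") (auto simp: dest: mult_le_mono[of 2 p 2 M])
    then have "c = 1"
      by (simp add: M_def)
    then show False
      using two_digits \<open>r0 = 0\<close> p2 by simp
  qed
  ultimately have p_less_n: "p < n" and r_n: "r = n + p"
    unfolding n_def r_eq by linarith+
  then have p_le_r: "p \<le> r"
    by simp
  have "n = r0 + p * (p * M - 1)"
    unfolding n_def r_eq diff_mult_distrib2 using pM \<open>2 * p \<le> p * (p * M)\<close> by simp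
  moreover have "p * M - 1 = (p - 1) + p * (M - 1)"
    using M_pos p0 by (cases M) simp_all
  ultimately have n_eq: "n = r0 + p * ((p - 1) + p * (M - 1))"
    by simp
  have S_ge_2: "2 \<le> S"
  proof -
    have "S = r0 + digit_sum p (c mod p + p * (c div p))"
      using p2 r0 by (simp add: S_def r_def digit_sum_add_mult digit_sum_mult digit_sum_power_mult del: power_Suc)
    also have "\<dots> = r0 + (c mod p + digit_sum p (c div p))"
      using p2 by (subst digit_sum_add_mult) simp_all
    finally have "S = r0 + (c mod p + digit_sum p (c div p))" .
    moreover have "c mod p > 0"
      using c by (simp add: dvd_eq_mod_eq_0)
    moreover have "0 < r0 \<or> 0 < digit_sum p (c div p)"
      using two_digits digit_sum_eq_0_iff[OF p2, of "c div p"] p0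
      by (metis div_eq_0_iff gr0I not_le)
    ultimately show ?thesis
      by linarith
  qed
  have r_cong: "[r = S] (mod (p - 1))"
    using cong_sym[OF digit_sum_cong[OF p2]] by (simp add: S_def)
  have p_cong: "[p = 1] (mod (p - 1))"
    using p2 le_mod_geq[of "p - 1" p] by (simp add: cong_def)
  have n_cong: "[Suc n = S] (mod (p - 1))"
  proof -
    have "[n + 1 = n + p] (mod (p - 1))"
      by (intro cong_add cong_refl cong_sym[OF p_cong])
    then show ?thesis
      using r_cong r_n by (auto intro: cong_trans)
  qed
  have pascal: "of_nat (lower_coeff p n x) + of_nat (n choose x) = (of_nat (r choose x) :: 'a)" for x
    using of_nat_eq_if_cong[OF choose_prime_pred_cong[OF prime_p, of r x]] p_le_r by (simp flip: n_def)
  have r_choose_p: "p dvd (r choose p)"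
    using prime_not_dvd_choose_step[OF prime_p r0 p0, of "p * M" 1] M_pos by (simp add: r_eq)
  have r_choose_n: "p dvd (r choose n)"
    using r_choose_p binomial_symmetric[of p r] r_n by simp
  have n_choose_p: "of_nat (n choose p) = (- 1 :: 'a)"
    using pascal[of p] r_choose_p of_nat_eq_0_iff_dvd[of "r choose p"]
    by (simp add: lower_coeff_def eq_neg_iff_add_eq_0 add.commute)
  have n_choose_n_p: "of_nat (n choose (n - p)) = (- 1 :: 'a)"
    using n_choose_p binomial_symmetric[of p n] p_less_n by simp
  have rel_0: "relation r 0 \<longleftrightarrow> \<delta> 0 n = 0"
    using p0 by (simp add: relation_def lower_coeff_def n_def)
  have rel_r: "relation r r \<longleftrightarrow> \<beta> n 0 = 0"
    using p0 r_n by (simp add: relation_def lower_coeff_def binomial_eq_0 flip: n_def)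
  have rel_p: "relation r p \<longleftrightarrow> \<beta> 0 n = \<delta> p (n - p)"
    using n_choose_p by (simp add: relation_def lower_coeff_def flip: n_def)
  have rel_n: "relation r n \<longleftrightarrow> \<delta> n 0 = \<beta> (n - p) p"
    using n_choose_n_p p_less_n r_n
    by (auto simp: relation_def lower_coeff_def simp flip: n_def)
  have inner_\<beta>: "\<beta> (x - p) (r - x) = \<beta> i j"
    if "p < x" "x < r" "i \<ge> 1" "j \<ge> 1" "[x = Suc i] (mod (p - 1))" "[Suc (i + j) = S] (mod (p - 1))" for x i j
  proof (rule \<beta>_cong)
    show "[x - p = i] (mod (p - 1))"
      by (rule cong_cancel_nat[OF _ p_cong]) (use that in simp)
    have "[r = Suc (i + j)] (mod (p - 1))"
      using that(6) r_cong by (meson cong_sym cong_trans)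
    moreover have "r - x + x = r" "j + Suc i = Suc (i + j)"
      using that(2) by simp_all
    ultimately have "[r - x + x = j + Suc i] (mod (p - 1))"
      by (simp only:)
    then show "[r - x = j] (mod (p - 1))"
      by (rule cong_cancel_nat[OF _ that(5)])
  qed (use that in auto)
  have inner_\<delta>: "\<delta> x (n - x) = \<delta> (Suc i) (j + (p - 2))"
    if "0 < x" "x < n" "j \<ge> 1" "[x = Suc i] (mod (p - 1))" "[Suc (i + j) = S] (mod (p - 1))" for x i j
  proof (rule \<delta>_cong)
    have "[r = Suc (i + j)] (mod (p - 1))"
      using that(5) r_cong by (meson cong_sym cong_trans)
    then have "[r = Suc (i + j) + (p - 1)] (mod (p - 1))"
      by (rule cong_add_modulus)
    moreover have "(n - x) + (p + x) = r" "j + (p - 2) + (1 + Suc i) = Suc (i + j) + (p - 1)"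
      using that(2) r_n p2 by simp_all
    ultimately have "[(n - x) + (p + x) = j + (p - 2) + (1 + Suc i)] (mod (p - 1))"
      by (simp only:)
    moreover have "[p + x = 1 + Suc i] (mod (p - 1))"
      using that(4) p_cong by (intro cong_add)
    ultimately show "[n - x = j + (p - 2)] (mod (p - 1))"
      by (rule cong_cancel_nat)
  qed (use that in auto)
  show ?thesis
    unfolding S_def[symmetric]
  proof
    assume rel: "\<forall>x\<le>r. relation r x"
    have zero: "\<beta> i j = 0 \<and> \<delta> (Suc i) (j + (p - 2)) = 0"
      if ij: "i \<ge> 1" "j \<ge> 1" "[Suc (i + j) = S] (mod (p - 1))"
        and k: "1 \<le> k" "k < S" "[Suc i = k] (mod (p - 1))" for i j k
    proof (rule digit_exchange[of r0 c k "Suc e"])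
      fix x
      assume "\<not> p dvd (r0 + p * (p ^ Suc e * c) choose x)" and x_sum: "digit_sum p x = k"
      then have nz: "\<not> p dvd (r choose x)"
        by (simp add: r_def)
      have "x \<le> r"
        using nz by (metis binomial_eq_0 dvd_0_right not_le)
      moreover have "x \<noteq> 0"
        using x_sum k(1) by (intro notI) simp
      moreover have "x \<noteq> r"
        using x_sum k(2) by (auto simp: S_def)
      ultimately have x_r: "0 < x" "x < r"
        by simp_all
      have x_ne: "x \<noteq> p" "x \<noteq> n"
        using nz r_choose_p r_choose_n by auto
      have x_cong: "[x = Suc i] (mod (p - 1))"
        using digit_sum_cong[OF p2, of x] k(3) x_sum by (auto intro: cong_sym cong_trans)
      have "lower_coeff p n x = 0" if "\<not> p < x"
        using that x_ne by (simp add: lower_coeff_def)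
      then have 1: "of_nat (lower_coeff p n x) * \<beta> (x - p) (r - x) = of_nat (lower_coeff p n x) * \<beta> i j"
        using inner_\<beta>[OF _ x_r(2) ij(1,2) x_cong ij(3)] by (cases "p < x") simp_all
      have "n choose x = 0" if "\<not> x < n"
        using that x_ne by (simp add: binomial_eq_0)
      then have 2: "of_nat (n choose x) * \<delta> x (n - x) = of_nat (n choose x) * \<delta> (Suc i) (j + (p - 2))"
        using inner_\<delta>[OF x_r(1) _ ij(2) x_cong ij(3)]
        by (cases "x < n") (simp_all del: binomial_eq_0_iff)
      show "of_nat (lower_coeff p (r0 + p * (p ^ Suc e * c) - p) x) * \<beta> i j
          + of_nat (r0 + p * (p ^ Suc e * c) - p choose x) * \<delta> (Suc i) (j + (p - 2)) = 0"
        using rel[rule_format, OF \<open>x \<le> r\<close>] unfolding relation_def r_def[symmetric] n_def[symmetric] 1 2 .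
    qed (use r0 c two_digits k in \<open>auto simp: S_def r_def\<close>)
    have linked_inner: "\<beta> i j = \<delta> (Suc i) (j + (p - 2))"
      if ij: "i \<ge> 1" "j \<ge> 1" "[Suc (i + j) = S] (mod (p - 1))" for i j
    proof -
      \<comment> \<open>The representative of \<open>i + 1\<close> modulo \<open>p - 1\<close> between \<open>1\<close> and \<open>p - 1\<close>.\<close>
      define k where "k = Suc (i mod (p - 1))"
      have k: "1 \<le> k" "k < p"
        using mod_less_divisor[of "p - 1" i] p2 unfolding k_def by linarith+
      have k_cong: "[k = Suc i] (mod (p - 1))"
        by (simp add: k_def cong_def mod_Suc_eq)
      show ?thesis
      proof (cases "k < S")
        case True
        then show ?thesis
          using zero[OF ij k(1) True cong_sym[OF k_cong]] by simp
      next
        case False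
        then have k2: "2 \<le> k"
          using S_ge_2 by simp
        \<comment> \<open>At \<open>x = p k\<close> the digit of \<open>n\<close> at position one is \<open>p - 1\<close> by the borrow, whereas that of \<open>r\<close> is zero: the coefficients are nonzero and opposite.\<close>
        have "\<not> p dvd (n choose (p * k))"
          using prime_not_dvd_choose_step[OF prime_p r0 p0, of "(p - 1) + p * (M - 1)" k]
            prime_not_dvd_choose_step[OF prime_p _ k(2), of "p - 1" "M - 1" 0] p2 k n_eq
          by auto
        moreover have "p dvd (r choose (p * k))"
          using prime_not_dvd_choose_step[OF prime_p r0 p0, of "p * M" k]
            prime_not_dvd_choose_step[OF prime_p p0 k(2), of M 0] k r_eq
          by auto
        ultimately have nz: "of_nat (n choose (p * k)) \<noteq> (0 :: 'a)"
          and neg: "of_nat (lower_coeff p n (p * k)) = - (of_nat (n choose (p * k)) :: 'a)"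
          using pascal[of "p * k"] of_nat_eq_0_iff_dvd by (simp_all add: eq_neg_iff_add_eq_0)
        have "p * k \<le> n"
          using nz by (metis binomial_eq_0 not_le of_nat_0)
        moreover have "p * k \<noteq> n"
        proof
          assume "p * k = n"
          then have eq: "p * k = r0 + p * ((p - 1) + p * (M - 1))"
            using n_eq by simp
          from arg_cong[OF eq, of "\<lambda>t. t mod p"] have "r0 = 0"
            using r0 by simp
          with eq have "k = (p - 1) + p * (M - 1)"
            using p0 by simp
          with k(2) have "M = 1"
            using M_pos by (cases "M - 1") auto
          then show False
            using two_digits \<open>r0 = 0\<close> p2 by (simp add: M_def)
        qed
        ultimately have x: "p < p * k" "p * k < n"
          using k2 p0 by auto
        have x_cong: "[p * k = Suc i] (mod (p - 1))"
          using cong_mult[OF p_cong k_cong] by simp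
        have "relation r (p * k)"
          using rel x r_n by simp
        then show ?thesis
          using nz neg inner_\<beta>[OF x(1) _ ij(1,2) x_cong ij(3)] inner_\<delta>[OF _ x(2) ij(2) x_cong ij(3)] x r_n
          by (simp add: relation_def flip: n_def)
      qed
    qed
    have ends: "\<delta> 0 n = 0" "\<beta> n 0 = 0" "\<beta> 0 n = \<delta> p (n - p)" "\<delta> n 0 = \<beta> (n - p) p"
      using rel rel_0 rel_r rel_p rel_n r_n by auto
    have "\<delta> 0 j = 0 \<and> \<beta> j 0 = 0 \<and> \<beta> 0 j = \<delta> 1 (j + (p - 2)) \<and> \<delta> j 0 = \<beta> (j + (p - 2)) 1"
      if j: "j \<ge> 1" "[Suc j = S] (mod (p - 1))" for j
    proof -
      have "[Suc j = Suc n] (mod (p - 1))"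
        using j(2) n_cong by (meson cong_sym cong_trans)
      then have j_n: "[j = n] (mod (p - 1))"
        using cong_add_rcancel_nat[of j 1 n "p - 1"] by simp
      have "[n = j + (p - 1)] (mod (p - 1))"
        by (rule cong_add_modulus[OF cong_sym[OF j_n]])
      moreover have "n - p + p = n" "j + (p - 2) + 1 = j + (p - 1)"
        using p_less_n p2 by simp_all
      ultimately have "[n - p + p = j + (p - 2) + 1] (mod (p - 1))"
        by (simp only:)
      then have n_p: "[n - p = j + (p - 2)] (mod (p - 1))"
        by (rule cong_cancel_nat[OF _ p_cong])
      have "\<delta> 0 j = \<delta> 0 n" "\<beta> j 0 = \<beta> n 0" "\<beta> 0 j = \<beta> 0 n" "\<delta> j 0 = \<delta> n 0"
        using j(1) p_less_n by (intro \<beta>_cong \<delta>_cong j_n cong_refl; simp)+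
      moreover have "\<delta> p (n - p) = \<delta> 1 (j + (p - 2))" "\<beta> (n - p) p = \<beta> (j + (p - 2)) 1"
        using j(1) p_less_n p0 by (intro \<beta>_cong \<delta>_cong n_p p_cong; simp)+
      ultimately show ?thesis
        using ends by simp
    qed
    with zero linked_inner show "linked S"
      unfolding linked_def by blast
  next
    assume linked: "linked S"
    have n1: "n \<ge> 1"
      using p_less_n by simp
    have n_p: "[n + (p - 2) = n - p] (mod (p - 1))"
    proof (rule cong_cancel_nat)
      have "n + (p - 2) + 1 = n + (p - 1)" "n - p + p = n"
        using p_less_n p2 by simp_all
      then show "[n + (p - 2) + 1 = n - p + p] (mod (p - 1))"
        using cong_sym[OF cong_add_modulus[OF cong_refl[of n]]] by (simp only:)
    qed (rule cong_sym[OF p_cong])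
    have "\<delta> 1 (n + (p - 2)) = \<delta> p (n - p)" "\<beta> (n + (p - 2)) 1 = \<beta> (n - p) p"
      using p_less_n p0 by (intro \<beta>_cong \<delta>_cong n_p cong_sym[OF p_cong]; simp)+
    then have ends: "\<delta> 0 n = 0" "\<beta> n 0 = 0" "\<beta> 0 n = \<delta> p (n - p)" "\<delta> n 0 = \<beta> (n - p) p"
      using linked n1 n_cong unfolding linked_def by metis+
    show "\<forall>x\<le>r. relation r x"
    proof (intro allI impI)
      fix x
      assume "x \<le> r"
      show "relation r x"
      proof (cases "x = 0 \<or> x = r \<or> x = p \<or> x = n")
        case True
        then show ?thesis
          using ends rel_0 rel_r rel_p rel_n by auto
      next
        case False
        \<comment> \<open>Representatives of \<open>x - 1\<close> and \<open>r - x\<close> that are positive even if \<open>x = 1\<close>.\<close>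
        define i j where "i = x + (p - 2)" and "j = r - x"
        have x: "0 < x" "x < r" "x \<noteq> p" "x \<noteq> n"
          using False \<open>x \<le> r\<close> by auto
        then have i1: "i \<ge> 1" and j1: "j \<ge> 1"
          by (simp_all add: i_def j_def)
        have Suc_i: "Suc i = x + (p - 1)"
          using p2 by (simp add: i_def)
        then have x_cong: "[x = Suc i] (mod (p - 1))"
          using cong_add_modulus[OF cong_refl[of x]] by (simp only:)
        have "Suc (i + j) = r + (p - 1)"
          using Suc_i x(2) by (simp add: j_def)
        then have ij: "[Suc (i + j) = S] (mod (p - 1))"
          using cong_sym[OF cong_add_modulus[OF cong_sym[OF r_cong]]] by (simp only:)
        have link: "\<delta> (Suc i) (j + (p - 2)) = \<beta> i j"
          using linked i1 j1 ij unfolding linked_def by metis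
        have "lower_coeff p n x = 0" if "\<not> p < x"
          using that x by (simp add: lower_coeff_def)
        then have 1: "of_nat (lower_coeff p n x) * \<beta> (x - p) (r - x) = of_nat (lower_coeff p n x) * \<beta> i j"
          using inner_\<beta>[OF _ x(2) i1 j1 x_cong ij] by (cases "p < x") simp_all
        have "n choose x = 0" if "\<not> x < n"
          using that x by (simp add: binomial_eq_0)
        then have 2: "of_nat (n choose x) * \<delta> x (n - x) = of_nat (n choose x) * \<beta> i j"
          using inner_\<delta>[OF x(1) _ j1 x_cong ij] link
          by (cases "x < n") (simp_all del: binomial_eq_0_iff)
        have "of_nat (r choose x) * \<beta> i j = 0"
        proof (cases "p dvd (r choose x)")
          case nz: False
          define k where "k = digit_sum p x"
          have "k + digit_sum p (r - x) = S"
            using digit_sum_add_if_not_dvd_choose[OF prime_p nz] by (simp add: k_def S_def)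
          moreover have "k \<noteq> 0" "digit_sum p (r - x) \<noteq> 0"
            using x by (simp_all add: k_def digit_sum_eq_0_iff[OF p2])
          ultimately have "1 \<le> k" "k < S"
            by linarith+
          moreover have "[Suc i = k] (mod (p - 1))"
            using cong_trans[OF cong_sym[OF x_cong] cong_sym[OF digit_sum_cong[OF p2]]] by (simp add: k_def)
          ultimately have "\<beta> i j = 0"
            using linked i1 j1 ij unfolding linked_def by metis
          then show ?thesis
            by simp
        qed (simp add: of_nat_eq_0_iff_dvd[THEN iffD2])
        then show ?thesis
          unfolding relation_def n_def[symmetric] 1 2 pascal[symmetric] distrib_right .
      qed
    qed
  qed
qed

end

section \<open>Substitution and the group action\<close>

lemma scal_simps:
  fixes F G :: "'a::comm_ring_1 poly poly"
  shows "scal c (F + G) = scal c F + scal c G" "scal (c + d) F = scal c F + scal d F"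
    "scal c (scal d F) = scal (c * d) F" "scal 1 F = F" "scal c 0 = 0" "scal 0 F = 0"
    "scal c F * G = scal c (F * G)" "F * scal c G = scal c (F * G)"
  by (simp_all add: scal_def smult_add_right mult.commute flip: smult_add_left one_pCons)

lemma scal_sum: "scal c (sum F A) = (\<Sum>x\<in>A. scal c (F x))" for c :: "'a::comm_ring_1"
  by (induction A rule: infinite_finite_induct) (simp_all add: scal_simps)

lemma scal_power: "scal c F ^ n = scal (c ^ n) (F ^ n)" for c :: "'a::comm_ring_1"
  by (induction n) (simp_all add: scal_simps mult.commute)

lemma coeff_scal: "coeff (coeff (scal c F) j) i = c * coeff (coeff F j) i"
  by (simp add: scal_def)

abbreviation monomial :: "nat \<Rightarrow> nat \<Rightarrow> 'a::comm_ring_1 poly poly" where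
  "monomial i j \<equiv> varX ^ i * varY ^ j"

lemma mono_eq_monom: "monomial i j = monom (monom 1 i) j"
proof -
  have "(varX :: 'a poly poly) ^ i = [:[:0, 1:] ^ i:]"
    by (induction i) (simp_all add: varX_def one_pCons)
  then show ?thesis
    by (simp add: varY_def monom_altdef)
qed

lemma product_of_powers_mult:
  fixes P Q :: "'a::comm_semiring_1"
  shows "P ^ i * Q ^ j * (P ^ k * Q ^ l) = P ^ (i + k) * Q ^ (j + l)"
  by (simp only: power_add mult.assoc mult.left_commute[of "Q ^ j"])

lemma coeff_mono: "coeff (coeff (monomial i j) y) x = (if x = i \<and> y = j then 1 else 0)"
  by (simp add: mono_eq_monom)

lemma coeff_mult_mono:
  "coeff (coeff (monomial i j * F) y) x = (if i \<le> x \<and> j \<le> y then coeff (coeff F (y - j)) (x - i) else 0)"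
  by (simp add: mono_eq_monom coeff_monom_mult)

lemma degree_bound:
  obtains M where "\<And>j. degree (coeff F j) \<le> M"
proof
  fix j
  show "degree (coeff F j) \<le> (\<Sum>j\<le>degree F. degree (coeff F j))"
  proof (cases "j \<le> degree F")
    case False
    then show ?thesis
      by (simp add: coeff_eq_0)
  qed (auto intro: member_le_sum)
qed

lemma subst2_eq_sum:
  fixes F :: "'a::comm_ring_1 poly poly"
  assumes "degree F \<le> N" "\<And>j. degree (coeff F j) \<le> M"
  shows "subst2 F P Q = (\<Sum>j\<le>N. \<Sum>i\<le>M. scal (coeff (coeff F j) i) (P ^ i * Q ^ j))"
proof -
  have "(\<Sum>i\<le>degree (coeff F j). scal (coeff (coeff F j) i) (P ^ i * Q ^ j))
      = (\<Sum>i\<le>M. scal (coeff (coeff F j) i) (P ^ i * Q ^ j))" for j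
    using assms(2)[of j] by (intro sum.mono_neutral_left) (auto simp: coeff_eq_0 scal_simps)
  then show ?thesis
    unfolding subst2_def
    using assms(1) by (simp, intro sum.mono_neutral_left) (auto simp: coeff_eq_0 scal_simps)
qed

lemma subst2_add:
  fixes F G :: "'a::comm_ring_1 poly poly"
  shows "subst2 (F + G) P Q = subst2 F P Q + subst2 G P Q"
proof -
  obtain M1 M2 where M: "degree (coeff F j) \<le> M1" "degree (coeff G j) \<le> M2" for j
    using degree_bound[of F] degree_bound[of G] by metis
  define N M where "N = max (degree F) (degree G)" and "M = max M1 M2"
  have F: "degree F \<le> N" "degree (coeff F j) \<le> M" and G: "degree G \<le> N" "degree (coeff G j) \<le> M" for j
    using M[of j] by (simp_all add: N_def M_def le_max_iff_disj)
  have "degree (F + G) \<le> N" "degree (coeff (F + G) j) \<le> M" for j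
    using F(1) G(1) F(2)[of j] G(2)[of j] by (simp_all add: degree_add_le)
  with F G show ?thesis
    by (simp add: subst2_eq_sum[of _ N M] scal_simps sum.distrib)
qed

lemma subst2_scal:
  fixes F :: "'a::comm_ring_1 poly poly"
  shows "subst2 (scal c F) P Q = scal c (subst2 F P Q)"
proof -
  obtain M where M: "degree (coeff F j) \<le> M" for j
    using degree_bound[of F] by metis
  have "degree (scal c F) \<le> degree F" "\<And>j. degree (coeff (scal c F) j) \<le> M"
    using M by (auto simp: scal_def degree_smult_le intro: order_trans[OF degree_smult_le])
  then show ?thesis
    using M by (simp add: subst2_eq_sum[of _ "degree F" M] scal_simps scal_sum coeff_scal)
qed

lemma subst2_0: "subst2 0 P Q = (0 :: 'a::comm_ring_1 poly poly)"
  by (simp add: subst2_def scal_simps)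

lemma subst2_sum: "subst2 (sum F A) P Q = (\<Sum>x\<in>A. subst2 (F x) P (Q :: 'a::comm_ring_1 poly poly))"
  by (induction A rule: infinite_finite_induct) (simp_all add: subst2_0 subst2_add)

lemma subst2_mono: "subst2 (monomial i j) P Q = P ^ i * (Q :: 'a::comm_ring_1 poly poly) ^ j"
proof -
  have "subst2 (monomial i j) P Q = (\<Sum>y\<le>j. \<Sum>x\<le>i. scal (coeff (coeff (monomial i j) y) x) (P ^ x * Q ^ y))"
    by (rule subst2_eq_sum) (auto simp: mono_eq_monom degree_monom_le)
  also have "\<dots> = (\<Sum>y\<le>j. \<Sum>x\<le>i. if x = i \<and> y = j then P ^ x * Q ^ y else 0)"
    by (intro sum.cong refl) (simp add: coeff_mono scal_simps)
  also have "\<dots> = (\<Sum>y\<le>j. if y = j then P ^ i * Q ^ y else 0)"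
    by (intro sum.cong refl) simp
  also have "\<dots> = P ^ i * Q ^ j"
    by simp
  finally show ?thesis .
qed

lemma sum_mono_eq:
  fixes F :: "'a::comm_ring_1 poly poly"
  assumes "degree F \<le> N" "\<And>j. degree (coeff F j) \<le> M"
  shows "F = (\<Sum>j\<le>N. \<Sum>i\<le>M. scal (coeff (coeff F j) i) (monomial i j))"
proof (intro poly_eqI)
  fix y x
  have "coeff (coeff (\<Sum>j\<le>N. \<Sum>i\<le>M. scal (coeff (coeff F j) i) (monomial i j)) y) x
      = (\<Sum>j\<le>N. \<Sum>i\<le>M. if x = i \<and> y = j then coeff (coeff F j) i else 0)"
    by (simp add: coeff_sum coeff_scal coeff_mono if_distrib cong: if_cong)
  also have "\<dots> = (\<Sum>j\<le>N. if y = j then (\<Sum>i\<le>M. if x = i then coeff (coeff F j) i else 0) else 0)"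
    by (intro sum.cong refl) simp
  also have "\<dots> = (if y \<le> N \<and> x \<le> M then coeff (coeff F y) x else 0)"
    by simp
  also have "\<dots> = coeff (coeff F y) x"
    using assms(1) assms(2)[of y] by (auto simp: coeff_eq_0)
  finally show "coeff (coeff F y) x
    = coeff (coeff (\<Sum>j\<le>N. \<Sum>i\<le>M. scal (coeff (coeff F j) i) (monomial i j)) y) x" by simp
qed

text \<open>
  Monomials span, so linear and multiplicative identities need to be checked on monomials only.
\<close>

lemma monomials_induct [case_names 0 add mono]:
  fixes F :: "'a::comm_ring_1 poly poly"
  assumes "R 0" "\<And>F G. R F \<Longrightarrow> R G \<Longrightarrow> R (F + G)" "\<And>c i j. R (scal c (monomial i j))"
  shows "R F"
proof -
  obtain M where "\<And>j. degree (coeff F j) \<le> M"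
    using degree_bound[of F] by metis
  have R_sum: "R (sum G A)" if "\<And>x. R (G x)" for G and A :: "nat set"
    using that assms(1,2) by (induction A rule: infinite_finite_induct) auto
  show ?thesis
    by (subst sum_mono_eq[OF order_refl \<open>\<And>j. degree (coeff F j) \<le> M\<close>]) (intro R_sum assms(3))
qed

lemma subst2_mult:
  fixes F G :: "'a::comm_ring_1 poly poly"
  shows "subst2 (F * G) P Q = subst2 F P Q * subst2 G P Q"
proof (induction F rule: monomials_induct)
  case (mono c i j)
  show ?case
  proof (induction G rule: monomials_induct)
    case (mono d k l)
    show ?case
      by (simp only: scal_simps subst2_scal subst2_mono product_of_powers_mult)
  qed (simp_all add: subst2_0 subst2_add distrib_left)
qed (simp_all add: subst2_0 subst2_add distrib_right)

lemma subst2_1: "subst2 1 P Q = (1 :: 'a::comm_ring_1 poly poly)"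
  using subst2_mono[of 0 0 P Q] by simp

lemma subst2_power: "subst2 (F ^ n) P Q = subst2 F P (Q :: 'a::comm_ring_1 poly poly) ^ n"
  by (induction n) (simp_all add: subst2_1 subst2_mult)

definition linear_form :: "'a::comm_ring_1 \<Rightarrow> 'a \<Rightarrow> 'a poly poly" where
  "linear_form a c = scal a varX + scal c varY"

lemma act_mono:
  "act g (monomial i j) = linear_form (g $ 1 $ 1) (g $ 2 $ 1) ^ i * linear_form (g $ 1 $ 2) (g $ 2 $ 2) ^ j"
  by (simp add: act_def subst2_mono linear_form_def)

lemma act_linear:
  "act g (F + G) = act g F + act g G" "act g (scal c F) = scal c (act g F)" "act g 0 = 0"
  "act g (sum H A) = (\<Sum>x\<in>A. act g (H x))"
  by (simp_all add: act_def subst2_add subst2_scal subst2_0 subst2_sum)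

lemma act_linear_form:
  "act g (linear_form a c) = linear_form (g $ 1 $ 1 * a + g $ 1 $ 2 * c) (g $ 2 $ 1 * a + g $ 2 $ 2 * c)"
proof -
  have "act g varX = linear_form (g $ 1 $ 1) (g $ 2 $ 1)" "act g varY = linear_form (g $ 1 $ 2) (g $ 2 $ 2)"
    using act_mono[of g 1 0] act_mono[of g 0 1] by simp_all
  then show ?thesis
    by (simp add: linear_form_def act_linear scal_simps mult.commute add.assoc add.left_commute)
qed

lemma act_act: "act g (act h F) = act (g ** h) F"
proof (induction F rule: monomials_induct)
  case (mono c i j)
  have "act g (act h (monomial i j)) =
      act g (linear_form (h $ 1 $ 1) (h $ 2 $ 1)) ^ i * act g (linear_form (h $ 1 $ 2) (h $ 2 $ 2)) ^ j"
    unfolding act_mono[of h] by (simp add: act_def subst2_mult subst2_power)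
  also have "\<dots> = act (g ** h) (monomial i j)"
    by (simp add: act_mono act_linear_form matrix_matrix_mult_def sum_2)
  finally show ?case
    by (simp add: act_linear)
qed (simp_all add: act_linear)

lemma act_mat_1: "act (mat 1) F = F"
proof (induction F rule: monomials_induct)
  case (mono c i j)
  then show ?case
    by (simp add: act_linear act_mono linear_form_def mat_def scal_simps)
qed (simp_all add: act_linear)

section \<open>Cyclic modules and annihilators\<close>

text \<open>
  A weight \<open>f\<close> on the group is an element of the group algebra, and \<open>orbit_comb u f\<close> is its action on \<open>u\<close>.
\<close>

definition orbit_comb :: "'a::{field,finite} poly poly \<Rightarrow> ('a ^ 2 ^ 2 \<Rightarrow> 'a) \<Rightarrow> 'a poly poly" where
  "orbit_comb u f = (\<Sum>g\<in>GL2. scal (f g) (act g u))"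

lemma orbit_comb_add: "orbit_comb u (\<lambda>g. f g + h g) = orbit_comb u f + orbit_comb u h"
  by (simp add: orbit_comb_def scal_simps sum.distrib)

lemma orbit_comb_scal: "orbit_comb u (\<lambda>g. c * f g) = scal c (orbit_comb u f)"
  by (simp add: orbit_comb_def scal_simps scal_sum)

lemma orbit_comb_diff: "orbit_comb u (\<lambda>g. f g - h g) = orbit_comb u f - orbit_comb u h"
  using orbit_comb_add[of u "\<lambda>g. f g - h g" h] by simp

lemma orbit_comb_act:
  assumes "h \<in> GL2"
  shows "act h (orbit_comb u f) = orbit_comb u (\<lambda>g. f (matrix_inv h ** g))"
proof -
  have h: "invertible h"
    using assms by (simp add: GL2_def)
  have "h ** matrix_inv h = mat 1 \<and> matrix_inv h ** h = mat 1"
    unfolding matrix_inv_def by (rule someI_ex) (use h in \<open>simp add: invertible_def\<close>)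
  then have inv: "h ** matrix_inv h = mat 1" "matrix_inv h ** h = mat 1"
    by simp_all
  have inv_h: "invertible (matrix_inv h)"
    using inv unfolding invertible_def by blast
  have "act h (orbit_comb u f) = (\<Sum>g\<in>GL2. scal (f g) (act (h ** g) u))"
    by (simp add: orbit_comb_def act_linear act_act)
  also have "\<dots> = orbit_comb u (\<lambda>g. f (matrix_inv h ** g))"
    unfolding orbit_comb_def
    by (rule sum.reindex_bij_witness[of _ "\<lambda>g. matrix_inv h ** g" "\<lambda>g. h ** g"])
      (use h inv_h in \<open>auto simp: GL2_def matrix_mul_assoc inv invertible_mult\<close>)
  finally show ?thesis .
qed

lemma orbit_comb_single: "orbit_comb u (\<lambda>g. if g = mat 1 then 1 else 0) = u"
proof -
  have "(mat 1 :: 'a ^ 2 ^ 2) \<in> GL2"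
    by (auto simp: GL2_def invertible_def intro: exI[of _ "mat 1"])
  then show ?thesis
    by (simp add: orbit_comb_def if_distrib[of "\<lambda>c. scal c _"] scal_simps act_mat_1 cong: if_cong)
qed

lemma orbit_comb_V: "u \<in> V n \<Longrightarrow> orbit_comb u f \<in> V n"
  unfolding orbit_comb_def by (intro V_sum V_scal act_V)

lemma submodule_hull_eq_range:
  assumes "u \<in> V n"
  shows "submodule_V n hull {u} = range (orbit_comb u)"
proof
  have "submodule_V n (range (orbit_comb u))"
    unfolding submodule_V_def module.subspace_def[OF module_scal]
  proof (intro conjI ballI allI)
    show "range (orbit_comb u) \<subseteq> V n"
      using orbit_comb_V[OF assms] by auto
    show "0 \<in> range (orbit_comb u)"
      by (rule range_eqI[of _ _ "\<lambda>_. 0"]) (simp add: orbit_comb_def scal_simps)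
  next
    fix F G assume "F \<in> range (orbit_comb u)" "G \<in> range (orbit_comb u)"
    then obtain f h where "F = orbit_comb u f" "G = orbit_comb u h"
      by auto
    then show "F + G \<in> range (orbit_comb u)"
      by (simp only: orbit_comb_add[symmetric] rangeI)
  next
    fix c F assume "F \<in> range (orbit_comb u)"
    then obtain f where "F = orbit_comb u f"
      by auto
    then show "scal c F \<in> range (orbit_comb u)"
      by (simp only: orbit_comb_scal[symmetric] rangeI)
  next
    fix g :: "'a ^ 2 ^ 2" and F assume "g \<in> GL2" "F \<in> range (orbit_comb u)"
    then show "act g F \<in> range (orbit_comb u)"
      by (auto simp: orbit_comb_act)
  qed
  moreover have "u \<in> range (orbit_comb u)"
    using rangeI[of "orbit_comb u" "\<lambda>g. if g = mat 1 then 1 else 0"]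
    by (simp only: orbit_comb_single)
  ultimately show "submodule_V n hull {u} \<subseteq> range (orbit_comb u)"
    by (intro hull_minimal) auto
next
  show "range (orbit_comb u) \<subseteq> submodule_V n hull {u}"
  proof (intro image_subsetI)
    fix f
    show "orbit_comb u f \<in> submodule_V n hull {u}"
      unfolding hull_def
    proof (intro InterI, clarify)
      fix W assume W: "submodule_V n W" "{u} \<subseteq> W"
      then have "module.subspace scal W" "\<And>g. g \<in> GL2 \<Longrightarrow> act g u \<in> W"
        by (auto simp: submodule_V_def)
      then show "orbit_comb u f \<in> W"
        unfolding orbit_comb_def
        by (intro module.subspace_sum[OF module_scal] module.subspace_scale[OF module_scal])
    qed
  qed
qed

text \<open>
  Both modules are the quotient of the free module of weights by the common annihilator.
\<close>

lemma GL2_isomorphic_if_same_annihilator: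
  fixes u v :: "'a::{field,finite} poly poly"
  assumes ann: "\<And>f. orbit_comb u f = 0 \<longleftrightarrow> orbit_comb v f = 0"
  shows "GL2_isomorphic (range (orbit_comb u)) (range (orbit_comb v))"
proof -
  define \<phi> where "\<phi> F = orbit_comb v (SOME f. orbit_comb u f = F)" for F
  have eq_iff: "orbit_comb u f = orbit_comb u h \<longleftrightarrow> orbit_comb v f = orbit_comb v h" for f h
    using ann[of "\<lambda>g. f g - h g"] by (simp add: orbit_comb_diff)
  have \<phi>: "\<phi> (orbit_comb u f) = orbit_comb v f" for f
    unfolding \<phi>_def eq_iff[symmetric] by (rule someI[of "\<lambda>h. orbit_comb u h = orbit_comb u f"]) (rule refl)
  show ?thesis
    unfolding GL2_isomorphic_def
  proof (intro exI[of _ \<phi>] conjI ballI allI)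
    have "inj_on \<phi> (range (orbit_comb u))"
      by (auto simp: inj_on_def \<phi> eq_iff)
    moreover have "\<phi> ` range (orbit_comb u) = range (orbit_comb v)"
      by (simp add: image_image \<phi>)
    ultimately show "bij_betw \<phi> (range (orbit_comb u)) (range (orbit_comb v))"
      by (simp add: bij_betw_def)
  next
    fix F G assume "F \<in> range (orbit_comb u)" "G \<in> range (orbit_comb u)"
    then show "\<phi> (F + G) = \<phi> F + \<phi> G"
      by (auto simp: \<phi> simp flip: orbit_comb_add)
  next
    fix c F assume "F \<in> range (orbit_comb u)"
    then show "\<phi> (scal c F) = scal c (\<phi> F)"
      by (auto simp: \<phi> simp flip: orbit_comb_scal)
  next
    fix g :: "'a ^ 2 ^ 2" and F assume "g \<in> GL2" "F \<in> range (orbit_comb u)"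
    then show "\<phi> (act g F) = act g (\<phi> F)"
      by (auto simp: \<phi> orbit_comb_act)
  qed
qed

section \<open>The orbit of a monomial\<close>

text \<open>
  The weights and the matrix entries are fixed by the Frobenius map, so taking \<open>p\<close>-th powers of
  polynomials commutes with the action and with linear combinations over the prime field. As \<open>p\<close>-th
  powers vanish only at \<open>0\<close>, the two monomials have the same annihilator.
\<close>

lemma orbit_comb_frobenius:
  fixes f :: "'a::{field,finite} ^ 2 ^ 2 \<Rightarrow> 'a"
  assumes "prime p" "CHAR('a) = p" and fermat: "\<And>x :: 'a. x ^ p = x"
  shows "orbit_comb (monomial (p * i) (p * j)) f = orbit_comb (monomial i j) f ^ p"
proof -
  have "orbit_comb (monomial i j) f ^ p = (\<Sum>g\<in>GL2. scal (f g) (act g (monomial i j)) ^ p)"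
    unfolding orbit_comb_def by (rule freshmans_dream_sum) (use assms in simp_all)
  also have "\<dots> = (\<Sum>g\<in>GL2. scal (f g) (act g (monomial (p * i) (p * j))))"
    by (intro sum.cong refl) (simp add: scal_power fermat act_mono power_mult_distrib mult.commute[of p] flip: power_mult)
  finally show ?thesis
    by (simp add: orbit_comb_def)
qed

lemma coeff_linear_form_power:
  "coeff (coeff (linear_form a c ^ n) y) x = (if x + y = n then of_nat (n choose x) * a ^ x * c ^ y else 0)"
proof -
  have "linear_form a c ^ n = (\<Sum>k\<le>n. scal (of_nat (n choose k) * a ^ k * c ^ (n - k)) (monomial k (n - k)))"
    unfolding linear_form_def binomial_ring
  proof (intro sum.cong refl)
    fix k
    have "of_nat m = (scal (of_nat m) 1 :: 'a poly poly)" for m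
      by (induction m) (simp_all add: scal_simps)
    from this[of "n choose k"] show "of_nat (n choose k) * scal a varX ^ k * scal c varY ^ (n - k)
        = scal (of_nat (n choose k) * a ^ k * c ^ (n - k)) (monomial k (n - k))"
      by (simp add: scal_simps scal_power mult_ac)
  qed
  then have "coeff (coeff (linear_form a c ^ n) y) x
      = (\<Sum>k\<le>n. of_nat (n choose k) * a ^ k * c ^ (n - k) * (if x = k \<and> y = n - k then 1 else 0))"
    by (simp add: coeff_sum coeff_scal coeff_mono)
  also have "\<dots> = (\<Sum>k\<le>n. if k = x then (if y = n - x then of_nat (n choose x) * a ^ x * c ^ (n - x) else 0) else 0)"
    by (intro sum.cong refl) auto
  finally have "coeff (coeff (linear_form a c ^ n) y) x
      = (if x \<le> n \<and> y = n - x then of_nat (n choose x) * a ^ x * c ^ (n - x) else 0)"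
    by simp
  then show ?thesis
    by auto
qed

lemma linear_form_power_prime:
  fixes b d :: "'a::field"
  assumes "prime p" "CHAR('a) = p" and fermat: "\<And>x :: 'a. x ^ p = x"
  shows "linear_form b d ^ p = scal b (monomial p 0) + scal d (monomial 0 p)"
  unfolding linear_form_def using assms(1,2)
  by (subst freshmans_dream) (simp_all add: scal_power fermat)

lemma power_cong_exponent:
  fixes x :: "'a::field"
  assumes fermat: "x ^ p = x" and "p > 0" "[i = j] (mod (p - 1))" "i = 0 \<longleftrightarrow> j = 0"
  shows "x ^ i = x ^ j"
proof (cases "x = 0")
  case False
  have "x ^ (p - 1) * x = x"
    using assms(1,2) by (cases p) (simp_all add: mult.commute)
  with False have 1: "x ^ (p - 1) = 1"
    by simp
  have "x ^ k = x ^ (k mod (p - 1))" for k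
  proof -
    have "x ^ k = x ^ ((p - 1) * (k div (p - 1)) + k mod (p - 1))"
      by simp
    also have "\<dots> = x ^ (k mod (p - 1))"
      by (simp only: power_add power_mult 1 power_one mult_1)
    finally show ?thesis .
  qed
  then show ?thesis
    using assms(3) unfolding cong_def by metis
qed (use assms in \<open>auto simp: power_0_left\<close>)

text \<open>
  Translation by \<open>1\<close> permutes the field, so comparing the sums of all elements shows that the
  cardinality is \<open>0\<close> in the field.
\<close>

lemma CHAR_eq_prime_CARD:
  assumes "CARD('a::finite_field) = p" "prime p"
  shows "CHAR('a) = p"
proof -
  have "(\<Sum>x\<in>UNIV. x) = (\<Sum>x\<in>UNIV. x + 1 :: 'a)"
    by (rule sum.reindex_bij_witness[of _ "\<lambda>x. x + 1" "\<lambda>x. x - 1"]) simp_all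
  then have "of_nat CARD('a) = (0 :: 'a)"
    by (simp add: sum.distrib)
  then have "CHAR('a) dvd p"
    using assms(1) by (simp add: of_nat_eq_0_iff_char_dvd)
  then show ?thesis
    using assms(2) CHAR_prime[where 'a = 'a] by (metis primes_dvd_imp_eq)
qed

lemma coeff_act_generator:
  fixes g :: "'a::{field,finite} ^ 2 ^ 2"
  assumes "prime p" "CHAR('a) = p" and fermat: "\<And>x :: 'a. x ^ p = x"
    and r: "p \<le> r" "x \<le> r"
  shows "coeff (coeff (act g (monomial (r - p) p)) (r - x)) x =
    of_nat (lower_coeff p (r - p) x) * (g $ 1 $ 2 * (g $ 1 $ 1) ^ (x - p) * (g $ 2 $ 1) ^ (r - x)) +
    of_nat ((r - p) choose x) * (g $ 2 $ 2 * (g $ 1 $ 1) ^ x * (g $ 2 $ 1) ^ (r - p - x))"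
proof -
  let ?L = "linear_form (g $ 1 $ 1) (g $ 2 $ 1) ^ (r - p)"
  have "act g (monomial (r - p) p) = scal (g $ 1 $ 2) (monomial p 0 * ?L) + scal (g $ 2 $ 2) (monomial 0 p * ?L)"
    unfolding act_mono linear_form_power_prime[OF assms(1-3)]
    by (simp add: scal_simps distrib_left mult.commute)
  then have "coeff (coeff (act g (monomial (r - p) p)) (r - x)) x =
      g $ 1 $ 2 * coeff (coeff (monomial p 0 * ?L) (r - x)) x +
      g $ 2 $ 2 * coeff (coeff (monomial 0 p * ?L) (r - x)) x"
    by (simp only: coeff_add coeff_scal)
  moreover have "coeff (coeff (monomial p 0 * ?L) (r - x)) x =
      of_nat (lower_coeff p (r - p) x) * ((g $ 1 $ 1) ^ (x - p) * (g $ 2 $ 1) ^ (r - x))"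
    using r unfolding coeff_mult_mono coeff_linear_form_power by (auto simp: lower_coeff_def)
  moreover have "coeff (coeff (monomial 0 p * ?L) (r - x)) x =
      of_nat ((r - p) choose x) * ((g $ 1 $ 1) ^ x * (g $ 2 $ 1) ^ (r - p - x))"
    using r unfolding coeff_mult_mono coeff_linear_form_power
    by (auto simp: binomial_eq_0 add.commute)
  ultimately show ?thesis
    by (simp add: algebra_simps)
qed

definition moment :: "('a::{field,finite} ^ 2 ^ 2 \<Rightarrow> 'a) \<Rightarrow> 2 \<Rightarrow> nat \<Rightarrow> nat \<Rightarrow> 'a" where
  "moment f k i j = (\<Sum>g\<in>GL2. f g * (g $ k $ 2 * (g $ 1 $ 1) ^ i * (g $ 2 $ 1) ^ j))"

lemma moments_moment:
  fixes f :: "'a::{field,finite} ^ 2 ^ 2 \<Rightarrow> 'a"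
  assumes "prime p" "CHAR('a) = p" and fermat: "\<And>x :: 'a. x ^ p = x"
  shows "moments p (moment f 1) (moment f 2)"
proof
  fix i j i' j' :: nat
  assume *: "[i = i'] (mod (p - 1))" "i = 0 \<longleftrightarrow> i' = 0" "[j = j'] (mod (p - 1))" "j = 0 \<longleftrightarrow> j' = 0"
  have "x ^ i = x ^ i'" "x ^ j = x ^ j'" for x :: 'a
    using power_cong_exponent[OF fermat prime_gt_0_nat[OF assms(1)]] * by blast+
  then show "moment f 1 i j = moment f 1 i' j'" "moment f 2 i j = moment f 2 i' j'"
    unfolding moment_def by (intro sum.cong refl; simp)+
qed (use assms in simp_all)

lemma orbit_comb_eq_0_iff:
  fixes f :: "'a::{field,finite} ^ 2 ^ 2 \<Rightarrow> 'a"
  assumes "prime p" "CHAR('a) = p" and fermat: "\<And>x :: 'a. x ^ p = x" and r: "p \<le> r"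
  shows "orbit_comb (monomial (r - p) p) f = 0 \<longleftrightarrow>
    (\<forall>x\<le>r. moments.relation p (moment f 1) (moment f 2) r x)"
proof -
  let ?F = "orbit_comb (monomial (r - p) p) f"
  interpret moments p "moment f 1" "moment f 2"
    using assms(1-3) by (rule moments_moment)
  have coeff_F: "coeff (coeff ?F (r - x)) x = 0 \<longleftrightarrow> relation r x" if "x \<le> r" for x
  proof -
    have "coeff (coeff ?F (r - x)) x =
      (\<Sum>g\<in>GL2. f g * coeff (coeff (act g (monomial (r - p) p)) (r - x)) x)"
      by (simp add: orbit_comb_def coeff_sum coeff_scal)
    also have "\<dots> = of_nat (lower_coeff p (r - p) x) * moment f 1 (x - p) (r - x)
      + of_nat ((r - p) choose x) * moment f 2 x (r - p - x)"
      unfolding coeff_act_generator[OF assms that] moment_def sum_distrib_left sum.distrib[symmetric]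
      by (intro sum.cong refl) (simp add: algebra_simps)
    finally show ?thesis
      by (simp add: relation_def)
  qed
  have "?F \<in> V r"
    using monomial_V[of "r - p" r] r by (intro orbit_comb_V) simp
  show ?thesis
  proof
    assume "?F = 0"
    then show "\<forall>x\<le>r. relation r x"
      using coeff_F by simp
  next
    assume rel: "\<forall>x\<le>r. relation r x"
    have "coeff (coeff ?F y) x = 0" for x y
    proof (cases "x + y = r")
      case True
      then show ?thesis
        using coeff_F[of x] rel by auto
    next
      case False
      then show ?thesis
        using \<open>?F \<in> V r\<close> by (auto simp: V_def)
    qed
    then show "?F = 0"
      by (intro poly_eqI) simp
  qed
qed

section \<open>Comparison of annihilators\<close>

text \<open>
  The negation says that at most one base-\<open>p\<close> digit of \<open>n\<close> is nonzero.
\<close>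

definition several_digits :: "nat \<Rightarrow> nat \<Rightarrow> bool" where
  "several_digits p n \<longleftrightarrow> (\<forall>a k. a < p \<longrightarrow> n \<noteq> a * p ^ k)"

lemma several_digits_if_not_dvd:
  assumes "\<not> p dvd n" "p \<le> n"
  shows "several_digits p n"
  unfolding several_digits_def
proof (intro allI impI notI)
  fix a k
  assume "a < p" "n = a * p ^ k"
  with assms show False
    by (cases k) auto
qed

lemma several_digits_mult:
  assumes "several_digits p n" "n > 0"
  shows "several_digits p (p * n)"
  unfolding several_digits_def
proof (intro allI impI notI)
  fix a k
  assume a: "a < p" and eq: "p * n = a * p ^ k"
  show False
  proof (cases k)
    case 0
    have "p * 1 \<le> p * n"
      using assms(2) by (intro mult_le_mono2) simp
    with 0 a eq show False
      by simp
  next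
    case (Suc k')
    with a eq have "n = a * p ^ k'"
      by (simp add: mult.left_commute)
    with a assms(1) show False
      by (auto simp: several_digits_def)
  qed
qed

text \<open>
  The relations that cut out the annihilator have, up to the residues of the exponents, the same
  solutions for all exponents with the same digit sum and the same vanishing behaviour of the digit at
  position one.
\<close>

lemma same_annihilator:
  fixes f :: "'a::{field,finite} ^ 2 ^ 2 \<Rightarrow> 'a" and r s :: nat
  assumes "prime p" "CHAR('a) = p" and fermat: "\<And>x :: 'a. x ^ p = x"
    and r: "p \<le> r" "several_digits p r" and s: "p \<le> s" "several_digits p s"
    and "digit_sum p r = digit_sum p s" "p dvd r div p \<longleftrightarrow> p dvd s div p"
  shows "orbit_comb (monomial (r - p) p) f = 0 \<longleftrightarrow> orbit_comb (monomial (s - p) p) f = 0"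
proof -
  interpret moments p "moment f 1" "moment f 2"
    using assms(1-3) by (rule moments_moment)
  have p0: "p > 0"
    using p_ge_2 by simp
  have rel: "(\<forall>x\<le>r. relation r x) \<longleftrightarrow>
     (if p dvd r div p then linked (digit_sum p r)
      else (\<forall>i j. Suc (i + j) = digit_sum p r \<longrightarrow> moment f 1 i j = 0 \<and> moment f 2 i j = 0))"
    if r: "p \<le> r" "several_digits p r" for r
  proof -
    define r0 e where "r0 = r mod p" and "e = multiplicity p (r div p)"
    have "r div p \<noteq> 0" "\<not> is_unit p"
      using r(1) p_ge_2 by (auto simp: div_eq_0_iff)
    then obtain c where c: "r div p = p ^ e * c" "\<not> p dvd c"
      unfolding e_def by (rule multiplicity_decompose')
    have r0: "r0 < p" and r_eq: "r = r0 + p * (p ^ e * c)"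
      using p0 by (simp_all add: r0_def flip: c(1))
    have "r0 = 0 \<Longrightarrow> r = c * p ^ Suc e"
      by (simp add: r_eq)
    then have two_digits: "0 < r0 \<or> p \<le> c"
      using r(2) unfolding several_digits_def by (metis gr0I not_le)
    show ?thesis
    proof (cases e)
      case 0
      then show ?thesis
        using relations_iff_no_borrow[OF r0 c(2) two_digits] c r_eq by simp
    next
      case (Suc e')
      then show ?thesis
        using relations_iff_borrow[OF r0 c(2) two_digits, of e'] c(1) unfolding r_eq by simp
    qed
  qed
  show ?thesis
    unfolding orbit_comb_eq_0_iff[OF assms(1-3) r(1)] orbit_comb_eq_0_iff[OF assms(1-3) s(1)]
      rel[OF r] rel[OF s] using assms(8,9) by simp
qed

theorem theorem1p4:
  fixes p r :: nat
  assumes "prime p" and "p \<ge> 3" and "CARD('a::finite_field) = p" and "r \<ge> 2 * p + 1"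
  shows "(digit_sum p (r - p) < digit_sum p (r - 1) \<longrightarrow>
            p dvd r \<and>
            GL2_isomorphic (Xsub (r - p) r :: 'a poly poly set) (Xsub (r div p - 1) (r div p)))
       \<and> (digit_sum p (r - p) = digit_sum p (r - 1) \<longrightarrow>
            GL2_isomorphic (Xsub (r - p) r :: 'a poly poly set) (Xsub (r - 1) r))
       \<and> (digit_sum p (r - p) > digit_sum p (r - 1) \<longrightarrow>
            GL2_isomorphic (Xsub (r - p) r :: 'a poly poly set) (Xsub (r * p - 1) (r * p)))"
proof -
  have p2: "p \<ge> 2" and p0: "p > 0"
    using assms(2) by simp_all
  have char: "CHAR('a) = p"
    using CHAR_eq_prime_CARD[OF assms(3,1)] .
  have fermat: "x ^ p = x" for x :: 'a
    using finite_field_power_card_eq_same[of x] assms(3) by simp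
  have Xsub_eq: "(Xsub m n :: 'a poly poly set) = range (orbit_comb (monomial m (n - m)))" if "m \<le> n" for m n
    unfolding Xsub_def using monomial_V[OF that] by (rule submodule_hull_eq_range)
  \<comment> \<open>By Frobenius, \<open>X^(n-1) Y\<close> may be replaced by \<open>X^(p(n-1)) Y^p\<close>.\<close>
  have isoI: "GL2_isomorphic (Xsub (r - p) r :: 'a poly poly set) (Xsub (n - 1) n)"
    if "n > 0" "\<And>f :: 'a ^ 2 ^ 2 \<Rightarrow> 'a. orbit_comb (monomial (r - p) p) f = 0 \<longleftrightarrow> orbit_comb (monomial (p * (n - 1)) p) f = 0" for n
  proof -
    have "orbit_comb (monomial (r - p) p) f = 0 \<longleftrightarrow> orbit_comb (monomial (n - 1) 1) f = 0" for f :: "'a ^ 2 ^ 2 \<Rightarrow> 'a"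
      using that(2)[of f] orbit_comb_frobenius[OF assms(1) char fermat, of "n - 1" 1 f] p0 by simp
    from GL2_isomorphic_if_same_annihilator[OF this] show ?thesis
      using Xsub_eq[of "r - p" r] Xsub_eq[of "n - 1" n] assms(4) that(1) by simp
  qed
  define r0 c where "r0 = r mod p" and "c = r div p"
  have r_eq: "r = r0 + p * c" and r0: "r0 < p"
    using p0 by (simp_all add: r0_def c_def)
  have c2: "c \<ge> 2"
    using assms(4) p0 by (simp add: c_def less_eq_div_iff_mult_less_eq)
  have r_p: "r - p = r0 + p * (c - 1)"
    using c2 by (cases c) (simp_all add: r_eq)
  have sum_r_p: "digit_sum p (r - p) = r0 + digit_sum p (c - 1)"
    unfolding r_p using p2 r0 by (rule digit_sum_add_mult)
  have sum_r: "digit_sum p r = r0 + digit_sum p c"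
    unfolding r_eq using p2 r0 by (rule digit_sum_add_mult)
  have dvd_iff: "p dvd r \<longleftrightarrow> r0 = 0"
    by (simp add: r0_def dvd_eq_mod_eq_0)
  have sum_r_1: "Suc (digit_sum p (r - 1)) = r0 + digit_sum p c" if "r0 \<noteq> 0"
    using digit_sum_pred[OF p2, of r] that dvd_iff sum_r by simp
  \<comment> \<open>If the last digit of \<open>r\<close> is zero, \<open>r - 1\<close> borrows; if the last digit of \<open>c\<close> is zero, \<open>r - p\<close> borrows; a borrow raises the digit sum.\<close>
  have case1: "digit_sum p (r - p) < digit_sum p (r - 1)" if "r0 = 0"
  proof -
    have "digit_sum p (r - 1) = p - 1 + digit_sum p (c - 1)"
      using digit_sum_pred_mult[OF p2, of c] c2 that r_eq by simp
    then show ?thesis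
      using sum_r_p that assms(2) by simp
  qed
  have case2: "digit_sum p (r - p) = digit_sum p (r - 1)" if "r0 \<noteq> 0" "\<not> p dvd c"
    using sum_r_1[OF that(1)] digit_sum_pred[OF p2 that(2)] sum_r_p by simp
  have case3: "digit_sum p (r - p) > digit_sum p (r - 1)" if "r0 \<noteq> 0" "p dvd c"
  proof -
    obtain m where m: "c = p * m"
      using \<open>p dvd c\<close> by blast
    have "m > 0"
      using m c2 by (cases m) simp_all
    then have "digit_sum p (c - 1) = p - 1 + digit_sum p (m - 1)"
      using digit_sum_pred_mult[OF p2] m by simp
    moreover have "digit_sum p c \<le> Suc (digit_sum p (m - 1))"
      using digit_sum_Suc_le[OF p2, of "m - 1"] \<open>m > 0\<close> m digit_sum_mult[OF p2] by simp
    ultimately show ?thesis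
      using sum_r_1[OF that(1)] sum_r_p p2 by linarith
  qed
  have several: "several_digits p r" if "r0 \<noteq> 0"
    using that dvd_iff assms(4) by (intro several_digits_if_not_dvd) simp_all
  consider "r0 = 0" | "r0 \<noteq> 0" "\<not> p dvd c" | "r0 \<noteq> 0" "p dvd c"
    by blast
  then show ?thesis
  proof cases
    case 1
    have "p * (c - 1) = r - p"
      using r_p 1 by simp
    then have "GL2_isomorphic (Xsub (r - p) r :: 'a poly poly set) (Xsub (c - 1) c)"
      using c2 by (intro isoI) simp_all
    then show ?thesis
      using case1[OF 1] dvd_iff 1 by (simp add: c_def)
  next
    case 2
    have "orbit_comb (monomial (r - p) p) f = 0 \<longleftrightarrow> orbit_comb (monomial (p * (r - 1)) p) f = 0" for f :: "'a ^ 2 ^ 2 \<Rightarrow> 'a"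
    proof -
      have "orbit_comb (monomial (r - p) p) f = 0 \<longleftrightarrow> orbit_comb (monomial (p * r - p) p) f = 0"
        by (rule same_annihilator[OF assms(1) char fermat])
          (use 2 assms(4) p0 dvd_iff several several_digits_mult[OF several]
            in \<open>auto simp: digit_sum_mult[OF p2] c_def\<close>)
      then show ?thesis
        by (simp add: diff_mult_distrib2)
    qed
    then have "GL2_isomorphic (Xsub (r - p) r :: 'a poly poly set) (Xsub (r - 1) r)"
      using assms(4) by (intro isoI) simp_all
    then show ?thesis
      using case2[OF 2] by simp
  next
    case 3
    have "orbit_comb (monomial (r - p) p) f = 0 \<longleftrightarrow> orbit_comb (monomial (p * (r * p - 1)) p) f = 0" for f :: "'a ^ 2 ^ 2 \<Rightarrow> 'a"
    proof -
      have "orbit_comb (monomial (r - p) p) f = 0 \<longleftrightarrow> orbit_comb (monomial (p * (p * r) - p) p) f = 0"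
        by (rule same_annihilator[OF assms(1) char fermat])
          (use 3 assms(4) p0 several several_digits_mult[OF several_digits_mult[OF several]]
            in \<open>auto simp: digit_sum_mult[OF p2] c_def\<close>)
      then show ?thesis
        by (simp add: diff_mult_distrib2 mult.commute)
    qed
    then have "GL2_isomorphic (Xsub (r - p) r :: 'a poly poly set) (Xsub (r * p - 1) (r * p))"
      using assms(4) p0 by (intro isoI) simp_all
    then show ?thesis
      using case3[OF 3] by simp
  qed
qed

end
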